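(* Let $R$ be a Noetherian commutative ring of prime characteristic $p>0$. Suppose that for each minimal prime $P$ of $R$, the domain $R/P$ has a module-finite extension domain $S \supseteq R/P$ (i.e. $S$ is a domain containing $R/P$ and finitely generated as an $R/P$-module) such that tight closure commutes with localization in $S$. Then tight closure commutes with localization in $R$.
   Context: All rings are commutative and Noetherian of prime characteristic $p>0$. For an ideal $I$ of a ring $A$ and $q=p^e$, $I^{[q]}$ denotes the ideal generated by $\{x^q : x\in I\}$. The tight closure $I^*$ of $I$ is the set of $z\in A$ for which there exists $c\in A$, not in any minimal prime of $A$, with $c z^q\in I^{[q]}$ for all $q=p^e \gg 0$. We say tight closure commutes with localization in $A$ if for every ideal $I$ of $A$ and every multiplicative system $U\subseteq A$, one has $I^*A[U^{-1}] = (IA[U^{-1}])^*$, where the right side is the tight closure in the ring $A[U^{-1}]$. *)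

theory Defs
  imports "HOL-Algebra.Algebra" "HOL-Computational_Algebra.Primes"
begin

definition has_char :: "('a, 'm) ring_scheme \<Rightarrow> nat \<Rightarrow> bool" where
  "has_char A p \<longleftrightarrow> Factorial_Ring.prime p \<and> [p] \<cdot>\<^bsub>A\<^esub> \<one>\<^bsub>A\<^esub> = \<zero>\<^bsub>A\<^esub>"

definition minimal_prime :: "'a set \<Rightarrow> ('a, 'm) ring_scheme \<Rightarrow> bool" where
  "minimal_prime P A \<longleftrightarrow> primeideal P A \<and>
     (\<forall>Q. primeideal Q A \<and> Q \<subseteq> P \<longrightarrow> Q = P)"

definition frob_power :: "('a, 'm) ring_scheme \<Rightarrow> 'a set \<Rightarrow> nat \<Rightarrow> 'a set" where
  "frob_power A I q = Idl\<^bsub>A\<^esub> ((\<lambda>x. x [^]\<^bsub>A\<^esub> q) ` I)"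

definition tight_closure :: "nat \<Rightarrow> ('a, 'm) ring_scheme \<Rightarrow> 'a set \<Rightarrow> 'a set" where
  "tight_closure p A I = {z \<in> carrier A. \<exists>c \<in> carrier A.
      (\<forall>P. minimal_prime P A \<longrightarrow> c \<notin> P) \<and>
      (\<exists>e0. \<forall>e\<ge>e0. c \<otimes>\<^bsub>A\<^esub> (z [^]\<^bsub>A\<^esub> (p ^ e)) \<in> frob_power A I (p ^ e))}"

definition mult_system :: "'a set \<Rightarrow> ('a, 'm) ring_scheme \<Rightarrow> bool" where
  "mult_system U A \<longleftrightarrow> U \<subseteq> carrier A \<and> \<one>\<^bsub>A\<^esub> \<in> U \<and>
     (\<forall>u\<in>U. \<forall>v\<in>U. u \<otimes>\<^bsub>A\<^esub> v \<in> U)"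

definition loc_rel :: "('a, 'm) ring_scheme \<Rightarrow> 'a set \<Rightarrow> ('a \<times> 'a) rel" where
  "loc_rel A U = {((a, u), (b, v)). a \<in> carrier A \<and> u \<in> U \<and> b \<in> carrier A \<and> v \<in> U \<and>
     (\<exists>w\<in>U. w \<otimes>\<^bsub>A\<^esub> ((a \<otimes>\<^bsub>A\<^esub> v) \<ominus>\<^bsub>A\<^esub> (b \<otimes>\<^bsub>A\<^esub> u)) = \<zero>\<^bsub>A\<^esub>)}"

definition frac :: "('a, 'm) ring_scheme \<Rightarrow> 'a set \<Rightarrow> 'a \<Rightarrow> 'a \<Rightarrow> ('a \<times> 'a) set" where
  "frac A U a u = loc_rel A U `` {(a, u)}"

definition loc_rep :: "('a \<times> 'a) set \<Rightarrow> 'a \<times> 'a" where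
  "loc_rep Xs = (SOME x. x \<in> Xs)"

definition localization :: "('a, 'm) ring_scheme \<Rightarrow> 'a set \<Rightarrow> ('a \<times> 'a) set ring" where
  "localization A U =
    \<lparr> carrier = (SIGMA a:carrier A. U) // loc_rel A U,
      monoid.mult = (\<lambda>Xs Ys. frac A U (fst (loc_rep Xs) \<otimes>\<^bsub>A\<^esub> fst (loc_rep Ys)) (snd (loc_rep Xs) \<otimes>\<^bsub>A\<^esub> snd (loc_rep Ys))),
      monoid.one = frac A U \<one>\<^bsub>A\<^esub> \<one>\<^bsub>A\<^esub>,
      ring.zero = frac A U \<zero>\<^bsub>A\<^esub> \<one>\<^bsub>A\<^esub>,
      ring.add = (\<lambda>Xs Ys. frac A U ((fst (loc_rep Xs) \<otimes>\<^bsub>A\<^esub> snd (loc_rep Ys)) \<oplus>\<^bsub>A\<^esub> (fst (loc_rep Ys) \<otimes>\<^bsub>A\<^esub> snd (loc_rep Xs)))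
                            (snd (loc_rep Xs) \<otimes>\<^bsub>A\<^esub> snd (loc_rep Ys))) \<rparr>"

definition loc_map :: "('a, 'm) ring_scheme \<Rightarrow> 'a set \<Rightarrow> 'a \<Rightarrow> ('a \<times> 'a) set" where
  "loc_map A U a = frac A U a \<one>\<^bsub>A\<^esub>"

definition ext_ideal :: "('a, 'm) ring_scheme \<Rightarrow> 'a set \<Rightarrow> 'a set \<Rightarrow> ('a \<times> 'a) set set" where
  "ext_ideal A U I = Idl\<^bsub>localization A U\<^esub> (loc_map A U ` I)"

definition tc_commutes_with_localization :: "nat \<Rightarrow> ('a, 'm) ring_scheme \<Rightarrow> bool" where
  "tc_commutes_with_localization p A \<longleftrightarrow>
     (\<forall>I U. ideal I A \<and> mult_system U A \<longrightarrow>
        ext_ideal A U (tight_closure p A I) =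
        tight_closure p (localization A U) (ext_ideal A U I))"

definition module_finite_ext ::
  "('a, 'm) ring_scheme \<Rightarrow> ('b, 'n) ring_scheme \<Rightarrow> ('a \<Rightarrow> 'b) \<Rightarrow> bool" where
  "module_finite_ext B S f \<longleftrightarrow> f \<in> ring_hom B S \<and> inj_on f (carrier B) \<and>
     (\<exists>Xs. finite Xs \<and> Xs \<subseteq> carrier S \<and>
        (\<forall>s\<in>carrier S. \<exists>g \<in> Xs \<rightarrow> carrier B.
            s = (\<Oplus>\<^bsub>S\<^esub> x\<in>Xs. f (g x) \<otimes>\<^bsub>S\<^esub> x)))"

end

theory Submission
  imports Defs
begin

text \<open>Tight closure in \<open>R\<close> can be tested modulo each minimal prime \<open>P\<close>: the multipliers for the finitely
  many \<open>P\<close> are glued by elements lying in all other minimal primes, and the nilpotent error disappears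
  under a power of Frobenius. If \<open>S\<close> is a module-finite extension domain of \<open>B = R/P\<close> and \<open>d \<noteq> 0\<close> in \<open>S\<close>,
  there is a \<open>B\<close>-linear \<open>\<theta> : S \<rightarrow> B\<close> with \<open>\<theta> d \<noteq> 0\<close>; applying \<open>\<theta>\<close> to \<open>d y\<^sup>q \<in> (I S)\<^sup>[\<^sup>q\<^sup>]\<close> shows that tight
  closure contracts from \<open>S\<close> to \<open>B\<close>.

  Now let \<open>z/1\<close> be in the tight closure of the extension of \<open>I\<close> to \<open>R[1/U]\<close>. If \<open>P\<close> misses \<open>U\<close>, push
  \<open>z\<close> to the localization of \<open>S\<close>, use the hypothesis on \<open>S\<close> to get \<open>u \<in> U\<close> with \<open>u z \<in> (I S)\<^sup>*\<close>, and
  contract to \<open>R/P\<close>. If \<open>P\<close> meets \<open>U\<close>, choose \<open>u \<in> P \<inter> U\<close>, so that \<open>u z\<close> vanishes in \<open>R/P\<close>. The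
  product \<open>v\<close> of these \<open>u\<close> satisfies \<open>v z \<in> I\<^sup>*\<close>.\<close>

section \<open>Frobenius powers and tight closure\<close>

context cring
begin

section \<open>Binomial expansion and additivity of the Frobenius map\<close>

lemma binomial_expansion:
  assumes x: "x \<in> carrier R" and y: "y \<in> carrier R"
  shows "(x \<oplus> y) [^] (n::nat) = (\<Oplus>k\<in>{..n}. [(n choose k)] \<cdot> (x [^] k \<otimes> y [^] (n - k)))"
proof (induction n)
  case 0
  then show ?case using x y by simp
next
  case (Suc n)
  define t where "t n k = [(n choose k)] \<cdot> (x [^] k \<otimes> y [^] (n - k))" for n k :: nat
  have t: "t n k \<in> carrier R" for n k using x y by (simp add: t_def)
  have top: "t n (Suc n) = \<zero>" by (simp add: t_def binomial_eq_0)
  have t0: "t (Suc n) 0 = t n 0 \<otimes> y" using x y by (simp add: t_def)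
  \<comment> \<open>Pascal's rule. For \<open>k = n\<close> the second summand vanishes by
    \<open>top\<close>; for \<open>k < n\<close> the exponent \<open>n - k\<close> is positive and
    supplies the factor \<open>y\<close>.\<close>
  have tS: "t (Suc n) (Suc k) = t n k \<otimes> x \<oplus> t n (Suc k) \<otimes> y" if "k \<le> n" for k
  proof (cases "k = n")
    case True
    then show ?thesis using x y top by (simp add: t_def m_ac)
  next
    case False
    then have "n - k = Suc (n - Suc k)" using that by simp
    then show ?thesis using x y
      by (simp add: t_def add.nat_pow_mult[symmetric] add_pow_ldistr add_pow_rdistr m_ac)
  qed
  have "(x \<oplus> y) [^] Suc n = (\<Oplus>k\<in>{..n}. t n k) \<otimes> (x \<oplus> y)"
    using Suc by (simp add: t_def)
  \<comment> \<open>The zero term \<open>t n (Suc n)\<close> is appended to the second sum so that,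
    once its index-0 term is split off, both sums run over the same range.\<close>
  also have "\<dots> = (\<Oplus>k\<in>{..n}. t n k) \<otimes> x \<oplus> (\<Oplus>k\<in>{..Suc n}. t n k) \<otimes> y"
    using x y t by (subst finsum_Suc) (auto simp: top r_distr)
  also have "(\<Oplus>k\<in>{..Suc n}. t n k) = (\<Oplus>k\<in>{..n}. t n (Suc k)) \<oplus> t n 0"
    using t by (subst finsum_Suc2) auto
  also have "(\<Oplus>k\<in>{..n}. t n k) \<otimes> x \<oplus> ((\<Oplus>k\<in>{..n}. t n (Suc k)) \<oplus> t n 0) \<otimes> y
     = (\<Oplus>k\<in>{..n}. t n k \<otimes> x \<oplus> t n (Suc k) \<otimes> y) \<oplus> t n 0 \<otimes> y"
    using x y t by (simp add: finsum_ldistr finsum_addf l_distr a_assoc Pi_def)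
  also have "\<dots> = (\<Oplus>k\<in>{..n}. t (Suc n) (Suc k)) \<oplus> t (Suc n) 0"
  proof -
    have "(\<Oplus>k\<in>{..n}. t n k \<otimes> x \<oplus> t n (Suc k) \<otimes> y) = (\<Oplus>k\<in>{..n}. t (Suc n) (Suc k))"
      by (rule finsum_cong') (use x y in \<open>auto simp: t tS\<close>)
    then show ?thesis by (simp add: t0)
  qed
  also have "\<dots> = (\<Oplus>k\<in>{..Suc n}. t (Suc n) k)"
    using t by (subst finsum_Suc2) auto
  finally show ?case by (simp add: t_def)
qed

text \<open>The prime \<open>p\<close> divides every inner binomial coefficient and
  \<open>p\<close>-fold sums vanish in characteristic \<open>p\<close>, so only the two end terms of
  the expansion survive.\<close>

lemma freshmans_dream:
  assumes p: "has_char R p" and x: "x \<in> carrier R" and y: "y \<in> carrier R"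
  shows "(x \<oplus> y) [^] p = x [^] p \<oplus> y [^] p"
proof -
  have pr: "Factorial_Ring.prime p" and p0: "[p] \<cdot> \<one> = \<zero>" using p by (auto simp: has_char_def)
  define t where "t k = [(p choose k)] \<cdot> (x [^] k \<otimes> y [^] (p - k))" for k
  have tc: "t k \<in> carrier R" for k using x y by (simp add: t_def)
  have pz: "[p] \<cdot> a = \<zero>" if "a \<in> carrier R" for a
    using add_pow_ldistr[OF one_closed that, of p] that p0 by simp
  have z: "t k = \<zero>" if "0 < k" "k < p" for k
  proof -
    from dvd_choose_prime[of k p] that pr obtain m where m: "p choose k = p * m" by (auto simp: dvd_def)
    show ?thesis
      unfolding t_def m using x y
      by (subst add.nat_pow_pow[symmetric]) (simp_all add: pz)
  qed
  have "p > 0" using pr prime_gt_0_nat by simp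
  have "(x \<oplus> y) [^] p = (\<Oplus>k\<in>{..p}. t k)"
    using binomial_expansion[OF x y, of p] by (simp add: t_def)
  also have "\<dots> = (\<Oplus>k\<in>{0,p}. t k)"
    by (rule add.finprod_mono_neutral_cong_right) (auto simp: tc intro!: z)
  also have "\<dots> = x [^] p \<oplus> y [^] p" 
    using \<open>p > 0\<close> x y tc by (simp add: finsum_insert) (simp add: t_def a_comm)
  finally show ?thesis .
qed

lemma freshmans_dream_pow:
  assumes p: "has_char R p" and x: "x \<in> carrier R" and y: "y \<in> carrier R"
  shows "(x \<oplus> y) [^] (p ^ e) = x [^] (p ^ e) \<oplus> y [^] (p ^ e)"
proof (induction e)
  case (Suc e)
  have "(x \<oplus> y) [^] (p ^ Suc e) = ((x \<oplus> y) [^] (p ^ e)) [^] p"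
    using x y by (simp add: nat_pow_pow mult.commute)
  also have "\<dots> = (x [^] (p ^ e)) [^] p \<oplus> (y [^] (p ^ e)) [^] p"
    using Suc x y p by (simp add: freshmans_dream)
  finally show ?case using x y by (simp add: nat_pow_pow mult.commute)
qed (use x y in simp)

text \<open>Closure under negatives follows from absorption of \<open>\<ominus> \<one>\<close>, and
  commutativity makes one-sided absorption enough.\<close>

lemma idealI_comm:
  assumes "I \<subseteq> carrier R" "\<zero> \<in> I"
    and add: "\<And>a b. \<lbrakk>a \<in> I; b \<in> I\<rbrakk> \<Longrightarrow> a \<oplus> b \<in> I"
    and mult: "\<And>a x. \<lbrakk>a \<in> I; x \<in> carrier R\<rbrakk> \<Longrightarrow> x \<otimes> a \<in> I"
  shows "ideal I R"
proof (rule idealI)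
  show "subgroup I (add_monoid R)"
  proof
    fix a assume a: "a \<in> I"
    then have "\<ominus> \<one> \<otimes> a \<in> I" by (intro mult) auto
    then have "\<ominus> a \<in> I" using a assms(1) by (auto simp: l_minus)
    then show "inv\<^bsub>add_monoid R\<^esub> a \<in> I" by (simp add: a_inv_def)
  qed (use assms in auto)
qed (use assms m_comm in \<open>auto intro: local.ring_axioms simp: subset_iff\<close>)

lemma prime_pow_notin:
  assumes "primeideal P R" "c \<in> carrier R" "c \<notin> P"
  shows "c [^] (n::nat) \<notin> P"
proof (induction n)
  case 0
  interpret P: primeideal P R by fact
  show ?case using P.I_notcarr P.one_imp_carrier by auto
next
  case (Suc n)
  then show ?case using assms primeideal.I_prime[OF assms(1), of "c [^] n" c] by auto
qed

text \<open>Additivity of Frobenius makes the defining condition additive. A statement about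
  \<open>p ^ e\<close>-th powers of all elements of a generated ideal can then be checked on
  generators.\<close>

lemma frobenius_preimage_ideal:
  assumes p: "has_char R p" and J: "ideal J R" and c: "c \<in> carrier R"
  shows "ideal {y \<in> carrier R. c \<otimes> y [^] (p ^ e) \<in> J} R"
proof -
  interpret J: ideal J R by fact
  have "p > 0" using p prime_gt_0_nat by (auto simp: has_char_def)
  show ?thesis
  proof (rule idealI_comm; clarsimp?)
    show "c \<otimes> \<zero> [^] (p ^ e) \<in> J" using c \<open>p > 0\<close> J.zero_closed by (simp add: nat_pow_zero)
  next
    fix a b assume "a \<in> carrier R" "b \<in> carrier R" "c \<otimes> a [^] (p ^ e) \<in> J" "c \<otimes> b [^] (p ^ e) \<in> J"
    then show "c \<otimes> (a \<oplus> b) [^] (p ^ e) \<in> J"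
      using c p by (simp add: freshmans_dream_pow r_distr J.a_closed)
  next
    fix a x assume a: "a \<in> carrier R" "x \<in> carrier R" "c \<otimes> a [^] (p ^ e) \<in> J"
    have "c \<otimes> (x \<otimes> a) [^] (p ^ e) = x [^] (p ^ e) \<otimes> (c \<otimes> a [^] (p ^ e))"
      using a c by (simp add: nat_pow_distrib m_ac)
    then show "c \<otimes> (x \<otimes> a) [^] (p ^ e) \<in> J" using a by (simp add: J.I_l_closed)
  qed
qed

section \<open>Frobenius powers and tight closures as ideals\<close>

lemma frob_power_ideal: "I \<subseteq> carrier R \<Longrightarrow> ideal (frob_power R I q) R"
  unfolding frob_power_def by (rule genideal_ideal) auto

lemma pow_mem_frob_power: "\<lbrakk>I \<subseteq> carrier R; x \<in> I\<rbrakk> \<Longrightarrow> x [^] q \<in> frob_power R I q"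
  unfolding frob_power_def by (rule subsetD[OF genideal_self]) auto

text \<open>For a sum, the two multipliers are combined into their product, which avoids each
  minimal prime because its factors do.\<close>

lemma tight_closure_ideal:
  assumes p: "has_char R p" and I: "I \<subseteq> carrier R"
  shows "ideal (tight_closure p R I) R"
proof -
  note fi = frob_power_ideal[OF I]
  have "p > 0" using p prime_gt_0_nat by (auto simp: has_char_def)
  show ?thesis
  proof (rule idealI_comm)
    show "tight_closure p R I \<subseteq> carrier R" by (auto simp: tight_closure_def)
    show "\<zero> \<in> tight_closure p R I"
      using \<open>p > 0\<close> additive_subgroup.zero_closed[OF ideal.axioms(1)[OF fi]]
        primeideal.I_notcarr ideal.one_imp_carrier primeideal.axioms(1)
      by (fastforce simp: tight_closure_def nat_pow_zero minimal_prime_def intro!: bexI[of _ \<one>])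
  next
    fix a b assume "a \<in> tight_closure p R I" "b \<in> tight_closure p R I"
    then obtain c d e1 e2 where a: "a \<in> carrier R" "c \<in> carrier R" "\<And>P. minimal_prime P R \<Longrightarrow> c \<notin> P"
        "\<And>e. e \<ge> e1 \<Longrightarrow> c \<otimes> a [^] (p ^ e) \<in> frob_power R I (p ^ e)"
      and b: "b \<in> carrier R" "d \<in> carrier R" "\<And>P. minimal_prime P R \<Longrightarrow> d \<notin> P"
        "\<And>e. e \<ge> e2 \<Longrightarrow> d \<otimes> b [^] (p ^ e) \<in> frob_power R I (p ^ e)"
      unfolding tight_closure_def by blast
    have "c \<otimes> d \<notin> P" if "minimal_prime P R" for P
      using that a b primeideal.I_prime[of P R c d] by (auto simp: minimal_prime_def)
    moreover have "(c \<otimes> d) \<otimes> (a \<oplus> b) [^] (p ^ e) \<in> frob_power R I (p ^ e)" if "e \<ge> max e1 e2" for e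
    proof -
      interpret F: ideal "frob_power R I (p ^ e)" R by (rule fi)
      have "(c \<otimes> d) \<otimes> (a \<oplus> b) [^] (p ^ e) =
          d \<otimes> (c \<otimes> a [^] (p ^ e)) \<oplus> c \<otimes> (d \<otimes> b [^] (p ^ e))"
        using a(1,2) b(1,2) p by (simp add: freshmans_dream_pow r_distr m_ac)
      then show ?thesis using a b that by (simp add: F.a_closed F.I_l_closed)
    qed
    ultimately show "a \<oplus> b \<in> tight_closure p R I"
      using a(1,2) b(1,2) unfolding tight_closure_def by (blast intro: a_closed m_closed)
  next
    fix a x assume "a \<in> tight_closure p R I" and x: "x \<in> carrier R"
    then obtain c e1 where a: "a \<in> carrier R" "c \<in> carrier R" "\<And>P. minimal_prime P R \<Longrightarrow> c \<notin> P"
        "\<And>e. e \<ge> e1 \<Longrightarrow> c \<otimes> a [^] (p ^ e) \<in> frob_power R I (p ^ e)"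
      unfolding tight_closure_def by blast
    have "c \<otimes> (x \<otimes> a) [^] (p ^ e) \<in> frob_power R I (p ^ e)" if "e \<ge> e1" for e
    proof -
      have "ideal {y \<in> carrier R. c \<otimes> y [^] (p ^ e) \<in> frob_power R I (p ^ e)} R"
        by (rule frobenius_preimage_ideal[OF p fi a(2)])
      from ideal.I_l_closed[OF this, of a x] show ?thesis using a that x by simp
    qed
    then show "x \<otimes> a \<in> tight_closure p R I"
      using a x unfolding tight_closure_def by blast
  qed
qed

end

lemma (in ring_hom_cring) hom_pow: "x \<in> carrier R \<Longrightarrow> h (x [^]\<^bsub>R\<^esub> (n::nat)) = h x [^]\<^bsub>S\<^esub> n"
  by (induction n) auto

text \<open>The preimage of the ideal on the right is an ideal of \<open>R\<close> containing
  \<open>E\<close>.\<close>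

lemma (in ring_hom_cring) hom_Idl:
  assumes "E \<subseteq> carrier R" "x \<in> Idl\<^bsub>R\<^esub> E"
  shows "h x \<in> Idl\<^bsub>S\<^esub> (h ` E)"
proof -
  have hX: "h ` E \<subseteq> carrier S" using assms by auto
  interpret J: ideal "Idl\<^bsub>S\<^esub> (h ` E)" S by (rule S.genideal_ideal[OF hX])
  have "ideal {x \<in> carrier R. h x \<in> Idl\<^bsub>S\<^esub> (h ` E)} R"
    by (rule R.idealI_comm) (auto simp: J.a_closed J.I_l_closed)
  from R.genideal_minimal[OF this, of E] show ?thesis
    using assms S.genideal_self[OF hX] by auto
qed

lemma (in ring_hom_cring) has_char_hom: "has_char R p \<Longrightarrow> has_char S p"
proof -
  have "h ([n] \<cdot>\<^bsub>R\<^esub> \<one>\<^bsub>R\<^esub>) = [n] \<cdot>\<^bsub>S\<^esub> \<one>\<^bsub>S\<^esub>" for n :: nat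
    by (induction n) auto
  then show "has_char R p \<Longrightarrow> has_char S p" unfolding has_char_def by (metis hom_zero)
qed

section \<open>Localization\<close>

text \<open>The set \<open>U\<close> may contain \<open>\<zero>\<close>; \<open>L\<close> is then
  the zero ring, which \<open>cring\<close> admits, so no case distinction is made.\<close>

locale localizing = cring R for R (structure) +
  fixes U
  assumes mult_system: "mult_system U R"
begin

abbreviation L where "L \<equiv> localization R U"

lemma U_carrier: "u \<in> U \<Longrightarrow> u \<in> carrier R"
  and U_one: "\<one> \<in> U"
  and U_mult: "\<lbrakk>u \<in> U; v \<in> U\<rbrakk> \<Longrightarrow> u \<otimes> v \<in> U"
  using mult_system unfolding mult_system_def by auto

lemma U_pow: "u \<in> U \<Longrightarrow> u [^] (n::nat) \<in> U"
  by (induction n) (auto simp: U_one U_mult)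

lemmas U_simps = U_carrier U_one U_mult U_pow

section \<open>Fractions and the ring structure of the localization\<close>

lemma loc_rel_iff:
  assumes "a \<in> carrier R" "u \<in> U" "b \<in> carrier R" "v \<in> U"
  shows "((a, u), (b, v)) \<in> loc_rel R U \<longleftrightarrow> (\<exists>w\<in>U. w \<otimes> (a \<otimes> v) = w \<otimes> (b \<otimes> u))"
proof -
  have "w \<otimes> (a \<otimes> v \<ominus> b \<otimes> u) = \<zero> \<longleftrightarrow> w \<otimes> (a \<otimes> v) = w \<otimes> (b \<otimes> u)" if "w \<in> U" for w
  proof -
    have "w \<otimes> (a \<otimes> v \<ominus> b \<otimes> u) = w \<otimes> (a \<otimes> v) \<ominus> w \<otimes> (b \<otimes> u)"
      using assms that by (simp add: U_simps minus_eq r_distr r_minus)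
    then show ?thesis using assms that by (simp add: U_simps r_right_minus_eq)
  qed
  then show ?thesis using assms unfolding loc_rel_def by auto
qed

lemma equiv_loc_rel: "equiv (carrier R \<times> U) (loc_rel R U)"
proof (rule equivI)
  show "loc_rel R U \<subseteq> (carrier R \<times> U) \<times> carrier R \<times> U" by (auto simp: loc_rel_def)
  show "refl_on (carrier R \<times> U) (loc_rel R U)"
    using U_one by (auto simp: refl_on_def loc_rel_iff) 
  show "sym (loc_rel R U)"
  proof (rule symI)
    fix x y assume *: "(x, y) \<in> loc_rel R U"
    then obtain a u b v where "x = (a, u)" "y = (b, v)" "a \<in> carrier R" "u \<in> U" "b \<in> carrier R" "v \<in> U"
      unfolding loc_rel_def by auto
    with * show "(y, x) \<in> loc_rel R U" by (metis loc_rel_iff)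
  qed
  show "trans (loc_rel R U)"
  proof (rule transI)
    fix x y z assume *: "(x, y) \<in> loc_rel R U" "(y, z) \<in> loc_rel R U"
    then obtain a u b v c w where xyz: "x = (a, u)" "y = (b, v)" "z = (c, w)"
      and car: "a \<in> carrier R" "u \<in> U" "b \<in> carrier R" "v \<in> U" "c \<in> carrier R" "w \<in> U"
      unfolding loc_rel_def by auto
    from * xyz car obtain s t where st: "s \<in> U" "t \<in> U" "s \<otimes> (a \<otimes> v) = s \<otimes> (b \<otimes> u)"
      "t \<otimes> (b \<otimes> w) = t \<otimes> (c \<otimes> v)" by (auto simp: loc_rel_iff)
    note carr = car st(1,2) car(2,4,6)[THEN U_carrier] st(1,2)[THEN U_carrier]
    \<comment> \<open>The middle denominator \<open>v\<close> has to join the multiplier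
      \<open>s \<otimes> t\<close>, since it cannot be cancelled from the two relations.\<close>
    have "(s \<otimes> t \<otimes> v) \<otimes> (a \<otimes> w) = (s \<otimes> (a \<otimes> v)) \<otimes> (t \<otimes> w)" using carr by (simp add: m_ac)
    also have "\<dots> = (t \<otimes> (b \<otimes> w)) \<otimes> (s \<otimes> u)" unfolding st(3) using carr by (simp add: m_ac)
    also have "\<dots> = (s \<otimes> t \<otimes> v) \<otimes> (c \<otimes> u)" unfolding st(4) using carr by (simp add: m_ac)
    finally show "(x, z) \<in> loc_rel R U"
      using carr unfolding xyz by (auto simp: loc_rel_iff intro!: bexI[of _ "s \<otimes> t \<otimes> v"] U_mult)
  qed
qed

lemma frac_eq_iff:
  assumes "a \<in> carrier R" "u \<in> U" "b \<in> carrier R" "v \<in> U"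
  shows "frac R U a u = frac R U b v \<longleftrightarrow> (\<exists>w\<in>U. w \<otimes> (a \<otimes> v) = w \<otimes> (b \<otimes> u))"
  unfolding frac_def loc_rel_iff[OF assms, symmetric]
  by (rule eq_equiv_class_iff[OF equiv_loc_rel]) (use assms in auto)

lemma frac_eqI:
  assumes "a \<in> carrier R" "u \<in> U" "b \<in> carrier R" "v \<in> U" "a \<otimes> v = b \<otimes> u"
  shows "frac R U a u = frac R U b v"
  using assms U_one by (auto simp: frac_eq_iff)

lemma frac_cancel:
  "\<lbrakk>a \<in> carrier R; u \<in> U; v \<in> U\<rbrakk> \<Longrightarrow> frac R U (v \<otimes> a) (v \<otimes> u) = frac R U a u"
  by (rule frac_eqI) (auto simp: U_simps m_ac)

lemma frac_closed [simp, intro]: "\<lbrakk>a \<in> carrier R; u \<in> U\<rbrakk> \<Longrightarrow> frac R U a u \<in> carrier L"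
  by (auto simp: localization_def frac_def intro!: quotientI)

lemma localization_cases:
  assumes "x \<in> carrier L"
  obtains a u where "a \<in> carrier R" "u \<in> U" "x = frac R U a u"
  using assms by (auto simp: localization_def frac_def elim!: quotientE)

text \<open>The operations of \<open>localization\<close> are computed on representatives picked by
  \<open>SOME\<close>; all that can be used about such a pick is that it is an equivalent
  fraction.\<close>

lemma loc_rep_frac:
  assumes "a \<in> carrier R" "u \<in> U"
  obtains b v where "loc_rep (frac R U a u) = (b, v)" "b \<in> carrier R" "v \<in> U"
    "frac R U b v = frac R U a u"
proof -
  have "(a, u) \<in> frac R U a u"
    unfolding frac_def using assms U_one by (auto simp: loc_rel_iff)
  then have "loc_rep (frac R U a u) \<in> frac R U a u" unfolding loc_rep_def by (rule someI)
  then have *: "((a, u), loc_rep (frac R U a u)) \<in> loc_rel R U" by (auto simp: frac_def)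
  obtain b v where bv: "loc_rep (frac R U a u) = (b, v)" by force
  with * have "b \<in> carrier R" "v \<in> U" by (auto simp: loc_rel_def)
  moreover have "frac R U b v = frac R U a u"
    using * bv equiv_class_eq[OF equiv_loc_rel] unfolding frac_def by metis
  ultimately show ?thesis using that bv by blast
qed

text \<open>Well-definedness of the product: the relations between chosen and given representatives
  are multiplied, with \<open>s \<otimes> t\<close> as common witness. \<open>frac_add\<close>
  follows the same scheme.\<close>

lemma frac_mult:
  assumes "a \<in> carrier R" "u \<in> U" "b \<in> carrier R" "v \<in> U"
  shows "frac R U a u \<otimes>\<^bsub>L\<^esub> frac R U b v = frac R U (a \<otimes> b) (u \<otimes> v)"
proof -
  obtain a' u' where a: "loc_rep (frac R U a u) = (a', u')" "a' \<in> carrier R" "u' \<in> U"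
    "frac R U a' u' = frac R U a u" using loc_rep_frac assms by metis
  obtain b' v' where b: "loc_rep (frac R U b v) = (b', v')" "b' \<in> carrier R" "v' \<in> U"
    "frac R U b' v' = frac R U b v" using loc_rep_frac assms by metis
  from a b assms obtain s t where st: "s \<in> U" "t \<in> U" "s \<otimes> (a' \<otimes> u) = s \<otimes> (a \<otimes> u')"
    "t \<otimes> (b' \<otimes> v) = t \<otimes> (b \<otimes> v')" by (auto simp: frac_eq_iff)
  note carr = assms a(2,3) b(2,3) st(1,2)
  note carr = carr assms(2,4)[THEN U_carrier] a(3)[THEN U_carrier] b(3)[THEN U_carrier] st(1,2)[THEN U_carrier]
  have "(s \<otimes> t) \<otimes> ((a' \<otimes> b') \<otimes> (u \<otimes> v)) = (s \<otimes> (a' \<otimes> u)) \<otimes> (t \<otimes> (b' \<otimes> v))"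
    using carr by (simp add: m_ac)
  also have "\<dots> = (s \<otimes> t) \<otimes> ((a \<otimes> b) \<otimes> (u' \<otimes> v'))"
    unfolding st using carr by (simp add: m_ac)
  finally have "frac R U (a' \<otimes> b') (u' \<otimes> v') = frac R U (a \<otimes> b) (u \<otimes> v)"
    using carr by (auto simp: frac_eq_iff U_simps)
  then show ?thesis by (simp add: localization_def a b)
qed

lemma frac_add:
  assumes "a \<in> carrier R" "u \<in> U" "b \<in> carrier R" "v \<in> U"
  shows "frac R U a u \<oplus>\<^bsub>L\<^esub> frac R U b v = frac R U (a \<otimes> v \<oplus> b \<otimes> u) (u \<otimes> v)"
proof -
  obtain a' u' where a: "loc_rep (frac R U a u) = (a', u')" "a' \<in> carrier R" "u' \<in> U"
    "frac R U a' u' = frac R U a u" using loc_rep_frac assms by metis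
  obtain b' v' where b: "loc_rep (frac R U b v) = (b', v')" "b' \<in> carrier R" "v' \<in> U"
    "frac R U b' v' = frac R U b v" using loc_rep_frac assms by metis
  from a b assms obtain s t where st: "s \<in> U" "t \<in> U" "s \<otimes> (a' \<otimes> u) = s \<otimes> (a \<otimes> u')"
    "t \<otimes> (b' \<otimes> v) = t \<otimes> (b \<otimes> v')" by (auto simp: frac_eq_iff)
  note carr = assms a(2,3) b(2,3) st(1,2)
  note carr = carr assms(2,4)[THEN U_carrier] a(3)[THEN U_carrier] b(3)[THEN U_carrier] st(1,2)[THEN U_carrier]
  have "(s \<otimes> t) \<otimes> ((a' \<otimes> v' \<oplus> b' \<otimes> u') \<otimes> (u \<otimes> v))
      = (s \<otimes> (a' \<otimes> u)) \<otimes> (t \<otimes> v \<otimes> v') \<oplus> (t \<otimes> (b' \<otimes> v)) \<otimes> (s \<otimes> u \<otimes> u')"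
    using carr by (simp add: m_ac l_distr r_distr)
  also have "\<dots> = (s \<otimes> t) \<otimes> ((a \<otimes> v \<oplus> b \<otimes> u) \<otimes> (u' \<otimes> v'))"
    unfolding st using carr by (simp add: m_ac l_distr r_distr)
  finally have "frac R U (a' \<otimes> v' \<oplus> b' \<otimes> u') (u' \<otimes> v') = frac R U (a \<otimes> v \<oplus> b \<otimes> u) (u \<otimes> v)"
    using carr by (auto simp: frac_eq_iff U_simps)
  then show ?thesis by (simp add: localization_def a b)
qed

lemma one_localization: "\<one>\<^bsub>L\<^esub> = frac R U \<one> \<one>"
  and zero_localization: "\<zero>\<^bsub>L\<^esub> = frac R U \<zero> \<one>"
  by (auto simp: localization_def)

lemma frac_zero: "u \<in> U \<Longrightarrow> frac R U \<zero> u = \<zero>\<^bsub>L\<^esub>"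
  unfolding zero_localization by (rule frac_eqI) (auto simp: U_simps)

lemma cring_localization: "cring L"
proof (rule cringI)
  show "abelian_group L"
  proof (rule abelian_groupI)
    fix x y z assume "x \<in> carrier L" "y \<in> carrier L" "z \<in> carrier L"
    then obtain a u b v c w where
      e: "x = frac R U a u" "y = frac R U b v" "z = frac R U c w"
      and car: "a \<in> carrier R" "u \<in> U" "b \<in> carrier R" "v \<in> U" "c \<in> carrier R" "w \<in> U"
      by (metis localization_cases)
    note carr = car car(2,4,6)[THEN U_carrier]
    show "x \<oplus>\<^bsub>L\<^esub> y \<in> carrier L" using carr by (simp add: e frac_add U_simps)
    show "x \<oplus>\<^bsub>L\<^esub> y \<oplus>\<^bsub>L\<^esub> z = x \<oplus>\<^bsub>L\<^esub> (y \<oplus>\<^bsub>L\<^esub> z)"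
      using carr by (simp add: e frac_add U_simps m_ac a_ac l_distr r_distr)
    show "x \<oplus>\<^bsub>L\<^esub> y = y \<oplus>\<^bsub>L\<^esub> x"
      using carr by (simp add: e frac_add U_simps m_comm a_comm)
  next
    fix x assume "x \<in> carrier L"
    then obtain a u where e: "x = frac R U a u" "a \<in> carrier R" "u \<in> U" by (metis localization_cases)
    then show "\<zero>\<^bsub>L\<^esub> \<oplus>\<^bsub>L\<^esub> x = x" by (simp add: zero_localization frac_add U_simps)
    have "frac R U (\<ominus> a) u \<oplus>\<^bsub>L\<^esub> x = \<zero>\<^bsub>L\<^esub>"
      using e by (simp add: frac_add U_simps l_minus l_neg frac_zero)
    then show "\<exists>y\<in>carrier L. y \<oplus>\<^bsub>L\<^esub> x = \<zero>\<^bsub>L\<^esub>" using e by blast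
  qed (simp add: zero_localization U_one)
  show "comm_monoid L"
  proof (rule comm_monoidI)
    fix x y z assume "x \<in> carrier L" "y \<in> carrier L" "z \<in> carrier L"
    then obtain a u b v c w where
      e: "x = frac R U a u" "y = frac R U b v" "z = frac R U c w"
      and car: "a \<in> carrier R" "u \<in> U" "b \<in> carrier R" "v \<in> U" "c \<in> carrier R" "w \<in> U"
      by (metis localization_cases)
    note carr = car car(2,4,6)[THEN U_carrier]
    show "x \<otimes>\<^bsub>L\<^esub> y \<in> carrier L" using carr by (simp add: e frac_mult U_simps)
    show "x \<otimes>\<^bsub>L\<^esub> y \<otimes>\<^bsub>L\<^esub> z = x \<otimes>\<^bsub>L\<^esub> (y \<otimes>\<^bsub>L\<^esub> z)"
      using carr by (simp add: e frac_mult U_simps m_ac)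
    show "x \<otimes>\<^bsub>L\<^esub> y = y \<otimes>\<^bsub>L\<^esub> x"
      using carr by (simp add: e frac_mult U_simps m_comm)
    show "\<one>\<^bsub>L\<^esub> \<otimes>\<^bsub>L\<^esub> x = x" using carr by (simp add: e one_localization frac_mult U_simps)
  qed (simp add: one_localization U_one)
  fix x y z assume "x \<in> carrier L" "y \<in> carrier L" "z \<in> carrier L"
  then obtain a u b v c w where
    e: "x = frac R U a u" "y = frac R U b v" "z = frac R U c w"
    and car: "a \<in> carrier R" "u \<in> U" "b \<in> carrier R" "v \<in> U" "c \<in> carrier R" "w \<in> U"
    by (metis localization_cases)
  note carr = car car(2,4,6)[THEN U_carrier]
  \<comment> \<open>The two sides of distributivity acquire the denominators
    \<open>u \<otimes> v \<otimes> w\<close> and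
    \<open>(u \<otimes> w) \<otimes> (v \<otimes> w)\<close>, so the left fraction is expanded by
    \<open>w\<close>.\<close>
  have "frac R U ((a \<otimes> v \<oplus> b \<otimes> u) \<otimes> c) (u \<otimes> v \<otimes> w) =
      frac R U (w \<otimes> ((a \<otimes> v \<oplus> b \<otimes> u) \<otimes> c)) (w \<otimes> (u \<otimes> v \<otimes> w))"
    using carr by (simp add: frac_cancel U_simps)
  then show "(x \<oplus>\<^bsub>L\<^esub> y) \<otimes>\<^bsub>L\<^esub> z = x \<otimes>\<^bsub>L\<^esub> z \<oplus>\<^bsub>L\<^esub> y \<otimes>\<^bsub>L\<^esub> z"
    using carr by (simp add: e frac_add frac_mult U_simps l_distr r_distr m_ac)
qed

sublocale L: cring L by (rule cring_localization)

lemma ring_hom_loc_map: "ring_hom_cring R L (loc_map R U)"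
proof -
  have "loc_map R U \<in> ring_hom R L"
    by (rule ring_hom_memI) (auto simp: loc_map_def U_simps frac_mult frac_add one_localization)
  then show ?thesis
    by (intro ring_hom_cringI ring_hom_ringI2 ring_axioms L.ring_axioms is_cring cring_localization)
qed

sublocale loc: ring_hom_cring R L "loc_map R U" by (rule ring_hom_loc_map)

lemma frac_pow:
  assumes "a \<in> carrier R" "u \<in> U"
  shows "frac R U a u [^]\<^bsub>L\<^esub> (n::nat) = frac R U (a [^] n) (u [^] n)"
  by (induction n) (use assms in \<open>auto simp: U_simps frac_mult one_localization\<close>)

lemma frac_factor: "\<lbrakk>a \<in> carrier R; u \<in> U\<rbrakk> \<Longrightarrow> frac R U a u = frac R U \<one> u \<otimes>\<^bsub>L\<^esub> loc_map R U a"
  by (simp add: loc_map_def frac_mult U_simps)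

text \<open>Together with \<open>frac_factor\<close> this shows that a/u and a/1 generate the same
  ideal of \<open>L\<close>, so denominators do not affect membership in an ideal.\<close>

lemma loc_map_factor: "\<lbrakk>a \<in> carrier R; u \<in> U\<rbrakk> \<Longrightarrow> loc_map R U a = loc_map R U u \<otimes>\<^bsub>L\<^esub> frac R U a u"
  using frac_cancel[of a \<one> u] by (simp add: loc_map_def frac_mult U_simps)

section \<open>Extended ideals and their Frobenius powers\<close>

lemma frac_ideal:
  assumes "ideal J R"
  shows "ideal {x. \<exists>a\<in>J. \<exists>u\<in>U. x = frac R U a u} L"
proof (rule L.idealI_comm)
  interpret J: ideal J R by fact
  show "{x. \<exists>a\<in>J. \<exists>u\<in>U. x = frac R U a u} \<subseteq> carrier L" by auto
  show "\<zero>\<^bsub>L\<^esub> \<in> {x. \<exists>a\<in>J. \<exists>u\<in>U. x = frac R U a u}"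
    using J.zero_closed U_one by (auto simp: zero_localization)
  fix x y assume "x \<in> {x. \<exists>a\<in>J. \<exists>u\<in>U. x = frac R U a u}" "y \<in> {x. \<exists>a\<in>J. \<exists>u\<in>U. x = frac R U a u}"
  then obtain a u b v where e: "x = frac R U a u" "y = frac R U b v" "a \<in> J" "u \<in> U" "b \<in> J" "v \<in> U"
    by auto
  then show "x \<oplus>\<^bsub>L\<^esub> y \<in> {x. \<exists>a\<in>J. \<exists>u\<in>U. x = frac R U a u}"
    unfolding mem_Collect_eq
    by (intro bexI[of _ "a \<otimes> v \<oplus> b \<otimes> u"] bexI[of _ "u \<otimes> v"])
      (auto simp: frac_add U_simps J.a_closed J.I_r_closed)
next
  interpret J: ideal J R by fact
  fix x y assume x: "x \<in> {x. \<exists>a\<in>J. \<exists>u\<in>U. x = frac R U a u}" and y: "y \<in> carrier L"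
  obtain b v where "y = frac R U b v" "b \<in> carrier R" "v \<in> U" by (rule localization_cases[OF y])
  with x obtain a u where e: "x = frac R U a u" "y = frac R U b v" "a \<in> J" "u \<in> U" "b \<in> carrier R" "v \<in> U"
    by blast
  then show "y \<otimes>\<^bsub>L\<^esub> x \<in> {x. \<exists>a\<in>J. \<exists>u\<in>U. x = frac R U a u}"
    unfolding mem_Collect_eq
    by (intro bexI[of _ "b \<otimes> a"] bexI[of _ "v \<otimes> u"])
      (auto simp: frac_mult U_simps J.I_l_closed)
qed

text \<open>Fractions with numerator in \<open>J\<close> already form an ideal, so generating adds
  nothing; conversely each of them is a multiple of the image of its numerator.\<close>

lemma ext_ideal_eq:
  assumes J: "ideal J R"
  shows "ext_ideal R U J = {x. \<exists>a\<in>J. \<exists>u\<in>U. x = frac R U a u}"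
proof
  interpret J: ideal J R by fact
  show "ext_ideal R U J \<subseteq> {x. \<exists>a\<in>J. \<exists>u\<in>U. x = frac R U a u}"
    unfolding ext_ideal_def
    by (rule L.genideal_minimal[OF frac_ideal[OF J]]) (use U_one in \<open>unfold loc_map_def, blast\<close>)
  have sub: "loc_map R U ` J \<subseteq> carrier L" by auto
  interpret E: ideal "ext_ideal R U J" L unfolding ext_ideal_def by (rule L.genideal_ideal[OF sub])
  show "{x. \<exists>a\<in>J. \<exists>u\<in>U. x = frac R U a u} \<subseteq> ext_ideal R U J"
  proof clarify
    fix a u assume "a \<in> J" "u \<in> U"
    moreover have "loc_map R U a \<in> ext_ideal R U J"
      unfolding ext_ideal_def using \<open>a \<in> J\<close> L.genideal_self[OF sub] by auto
    ultimately show "frac R U a u \<in> ext_ideal R U J"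
      by (subst frac_factor) (auto intro: E.I_l_closed simp: U_simps)
  qed
qed

lemma ext_ideal_ideal: "ideal J R \<Longrightarrow> ideal (ext_ideal R U J) L"
  by (simp add: ext_ideal_eq frac_ideal)

text \<open>Brings membership questions in \<open>L\<close> back to \<open>R\<close>. The factor
  \<open>w\<close> remains because \<open>J\<close> need not be saturated with respect to
  \<open>U\<close>; if \<open>w\<close> witnesses a/u = b/v with \<open>b\<close> in
  \<open>J\<close>, then \<open>w \<otimes> v\<close> is the factor.\<close>

lemma frac_mem_ext_ideal_iff:
  assumes J: "ideal J R" and a: "a \<in> carrier R" "u \<in> U"
  shows "frac R U a u \<in> ext_ideal R U J \<longleftrightarrow> (\<exists>w\<in>U. w \<otimes> a \<in> J)"
proof
  interpret J: ideal J R by fact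
  assume "frac R U a u \<in> ext_ideal R U J"
  then obtain b v where bv: "b \<in> J" "v \<in> U" "frac R U a u = frac R U b v"
    unfolding ext_ideal_eq[OF J] by blast
  then obtain w where w: "w \<in> U" "w \<otimes> (a \<otimes> v) = w \<otimes> (b \<otimes> u)"
    using frac_eq_iff[OF a J.Icarr bv(2)] by blast
  have "(w \<otimes> v) \<otimes> a = w \<otimes> (a \<otimes> v)" using w bv a by (simp add: U_simps m_ac)
  also have "\<dots> \<in> J" unfolding w using w bv a by (simp add: J.I_l_closed J.I_r_closed U_simps)
  finally show "\<exists>w\<in>U. w \<otimes> a \<in> J" using w bv by (blast intro: U_mult)
next
  assume "\<exists>w\<in>U. w \<otimes> a \<in> J"
  then obtain w where w: "w \<in> U" "w \<otimes> a \<in> J" by blast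
  then have "frac R U a u = frac R U (w \<otimes> a) (w \<otimes> u)" using a by (simp add: frac_cancel)
  then show "frac R U a u \<in> ext_ideal R U J" using w a U_mult unfolding ext_ideal_eq[OF J] by blast
qed

text \<open>The \<open>q\<close>-th power of a/u is the fraction of the \<open>q\<close>-th powers,
  and its denominator stays in \<open>U\<close>; both inclusions are checked on generators.\<close>

lemma frob_power_ext_ideal:
  assumes I: "ideal I R"
  shows "frob_power L (ext_ideal R U I) q = ext_ideal R U (frob_power R I q)"
proof
  interpret I: ideal I R by fact
  have F: "ideal (frob_power R I q) R" by (rule frob_power_ideal) auto
  interpret E: ideal "ext_ideal R U I" L by (rule ext_ideal_ideal[OF I])
  show "frob_power L (ext_ideal R U I) q \<subseteq> ext_ideal R U (frob_power R I q)"
    unfolding frob_power_def[of L]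
  proof (rule L.genideal_minimal[OF ext_ideal_ideal[OF F]])
    show "(\<lambda>x. x [^]\<^bsub>L\<^esub> q) ` ext_ideal R U I \<subseteq> ext_ideal R U (frob_power R I q)"
    proof clarify
      fix x assume "x \<in> ext_ideal R U I"
      then obtain a u where au: "a \<in> I" "u \<in> U" "x = frac R U a u" by (auto simp: ext_ideal_eq[OF I])
      have "a [^] q \<in> frob_power R I q" by (rule pow_mem_frob_power[OF I.a_subset au(1)])
      moreover have "x [^]\<^bsub>L\<^esub> q = frac R U (a [^] q) (u [^] q)" using au by (simp add: frac_pow)
      ultimately show "x [^]\<^bsub>L\<^esub> q \<in> ext_ideal R U (frob_power R I q)"
        using U_pow[OF au(2)] unfolding ext_ideal_eq[OF F] by blast
    qed
  qed
  have P: "ideal (frob_power L (ext_ideal R U I) q) L"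
    by (rule L.frob_power_ideal) (rule E.a_subset)
  have "loc_map R U ` frob_power R I q \<subseteq> frob_power L (ext_ideal R U I) q"
  proof
    fix y assume "y \<in> loc_map R U ` frob_power R I q"
    then obtain x where x: "x \<in> frob_power R I q" "y = loc_map R U x" by auto
    then have "y \<in> Idl\<^bsub>L\<^esub> (loc_map R U ` ((\<lambda>x. x [^] q) ` I))"
      unfolding frob_power_def by (auto intro!: loc.hom_Idl)
    also have "\<dots> \<subseteq> frob_power L (ext_ideal R U I) q"
    proof (rule L.genideal_minimal[OF P])
      have "loc_map R U a \<in> ext_ideal R U I" if "a \<in> I" for a
        using that U_one by (auto simp: ext_ideal_eq[OF I] loc_map_def)
      then show "loc_map R U ` ((\<lambda>x. x [^] q) ` I) \<subseteq> frob_power L (ext_ideal R U I) q"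
        by (auto simp: loc.hom_pow intro!: L.pow_mem_frob_power E.a_subset)
    qed
    finally show "y \<in> frob_power L (ext_ideal R U I) q" .
  qed
  then show "ext_ideal R U (frob_power R I q) \<subseteq> frob_power L (ext_ideal R U I) q"
    unfolding ext_ideal_def[of _ _ "frob_power R I q"] by (rule L.genideal_minimal[OF P])
qed

section \<open>Primes and minimal primes of the localization\<close>

lemma ext_ideal_prime:
  assumes P: "primeideal P R" and disj: "P \<inter> U = {}"
  shows "primeideal (ext_ideal R U P) L"
proof (rule primeidealI)
  interpret P: primeideal P R by fact
  \<comment> \<open>A prime missing \<open>U\<close> is saturated, so the factor \<open>w\<close> of
    the membership criterion disappears.\<close>
  have sat: "frac R U a u \<in> ext_ideal R U P \<longleftrightarrow> a \<in> P" if "a \<in> carrier R" "u \<in> U" for a u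
  proof -
    have "(\<exists>w\<in>U. w \<otimes> a \<in> P) \<longleftrightarrow> a \<in> P"
    proof
      assume "\<exists>w\<in>U. w \<otimes> a \<in> P"
      then show "a \<in> P" using P.I_prime[OF U_carrier that(1)] disj by auto
    next
      assume "a \<in> P"
      then show "\<exists>w\<in>U. w \<otimes> a \<in> P" using U_one that by (auto intro!: bexI[of _ \<one>])
    qed
    then show ?thesis using that by (simp add: frac_mem_ext_ideal_iff[OF P.is_ideal])
  qed
  show "ideal (ext_ideal R U P) L" by (rule ext_ideal_ideal) (rule P.is_ideal)
  show "cring L" by (rule cring_localization)
  have "\<one> \<notin> P" using disj U_one by auto
  then show "carrier L \<noteq> ext_ideal R U P" using sat[of \<one> \<one>] U_one by auto
  fix x y assume "x \<in> carrier L" "y \<in> carrier L" and xy: "x \<otimes>\<^bsub>L\<^esub> y \<in> ext_ideal R U P"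
  then obtain a u b v where e: "x = frac R U a u" "y = frac R U b v"
    "a \<in> carrier R" "u \<in> U" "b \<in> carrier R" "v \<in> U" by (metis localization_cases)
  then have "a \<otimes> b \<in> P" using xy by (simp add: frac_mult sat U_simps)
  then show "x \<in> ext_ideal R U P \<or> y \<in> ext_ideal R U P" using e P.I_prime by (auto simp: sat)
qed

lemma loc_map_mem_ext_prime_iff:
  assumes P: "primeideal P R" and disj: "P \<inter> U = {}" and a: "a \<in> carrier R"
  shows "loc_map R U a \<in> ext_ideal R U P \<longleftrightarrow> a \<in> P"
proof -
  have "loc_map R U a \<in> ext_ideal R U P \<longleftrightarrow> (\<exists>w\<in>U. w \<otimes> a \<in> P)"
    unfolding loc_map_def by (rule frac_mem_ext_ideal_iff[OF primeideal.axioms(1)[OF P] a U_one])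
  also have "\<dots> \<longleftrightarrow> a \<in> P"
  proof
    assume "\<exists>w\<in>U. w \<otimes> a \<in> P"
    then show "a \<in> P" using primeideal.I_prime[OF P U_carrier a] disj by auto
  next
    assume "a \<in> P"
    then show "\<exists>w\<in>U. w \<otimes> a \<in> P" using U_one a by (intro bexI[of _ \<one>]) auto
  qed
  finally show ?thesis .
qed

lemma contraction_prime:
  assumes Q: "primeideal Q L"
  shows "primeideal {a \<in> carrier R. loc_map R U a \<in> Q} R"
    and "{a \<in> carrier R. loc_map R U a \<in> Q} \<inter> U = {}"
proof -
  interpret Q: primeideal Q L by fact
  have one: "\<one>\<^bsub>L\<^esub> \<notin> Q" using Q.I_notcarr Q.one_imp_carrier by auto
  show "primeideal {a \<in> carrier R. loc_map R U a \<in> Q} R"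
  proof (rule primeidealI)
    show "ideal {a \<in> carrier R. loc_map R U a \<in> Q} R"
      by (rule idealI_comm) (auto simp: Q.a_closed Q.I_l_closed)
    show "cring R" by (rule is_cring)
    have "\<one> \<notin> {a \<in> carrier R. loc_map R U a \<in> Q}" using one by simp
    then show "carrier R \<noteq> {a \<in> carrier R. loc_map R U a \<in> Q}" by blast
  qed (use Q.I_prime in auto)
  \<comment> \<open>The image of \<open>u\<close> is a unit with inverse
    \<open>frac R U \<one> u\<close>, so \<open>Q\<close> would contain one.\<close>
  have False if "u \<in> U" "loc_map R U u \<in> Q" for u
  proof -
    have "\<one>\<^bsub>L\<^esub> = loc_map R U u \<otimes>\<^bsub>L\<^esub> frac R U \<one> u"
      using loc_map_factor[of \<one> u] that by simp
    also have "\<dots> \<in> Q" using that by (simp add: Q.I_r_closed)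
    finally show False using one by simp
  qed
  then show "{a \<in> carrier R. loc_map R U a \<in> Q} \<inter> U = {}" by blast
qed

lemma frac_mem_ideal_iff:
  assumes Q: "ideal Q L" and a: "a \<in> carrier R" "u \<in> U"
  shows "frac R U a u \<in> Q \<longleftrightarrow> loc_map R U a \<in> Q"
proof
  interpret Q: ideal Q L by fact
  show "loc_map R U a \<in> Q" if "frac R U a u \<in> Q"
    unfolding loc_map_factor[OF a] using that a U_carrier by (intro Q.I_l_closed) auto
  show "frac R U a u \<in> Q" if "loc_map R U a \<in> Q"
    using that a by (subst frac_factor) (auto intro: Q.I_l_closed simp: U_simps)
qed

text \<open>A prime below the contraction misses \<open>U\<close>, so it extends to a prime below
  \<open>Q\<close>, which minimality makes equal to \<open>Q\<close>; contracting back recovers the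
  prime.\<close>

lemma contraction_minimal_prime:
  assumes "minimal_prime Q L"
  shows "minimal_prime {a \<in> carrier R. loc_map R U a \<in> Q} R"
proof -
  have Q: "primeideal Q L" using assms by (simp add: minimal_prime_def)
  note Qi = primeideal.axioms(1)[OF Q]
  have "P' = {a \<in> carrier R. loc_map R U a \<in> Q}"
    if P': "primeideal P' R" and sub: "P' \<subseteq> {a \<in> carrier R. loc_map R U a \<in> Q}" for P'
  proof -
    have disj: "P' \<inter> U = {}" using contraction_prime(2)[OF Q] sub by blast
    have "ext_ideal R U P' \<subseteq> Q"
      unfolding ext_ideal_def by (rule L.genideal_minimal[OF Qi]) (use sub in auto)
    then have "ext_ideal R U P' = Q"
      using assms ext_ideal_prime[OF P' disj] by (auto simp: minimal_prime_def)
    then show ?thesis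
      using loc_map_mem_ext_prime_iff[OF P' disj] sub by blast
  qed
  then show ?thesis using contraction_prime(1)[OF Q] by (auto simp: minimal_prime_def)
qed

text \<open>A prime below the extension contracts into \<open>P\<close>, hence onto \<open>P\<close>
  by minimality, so it contains the generators of the extension.\<close>

lemma ext_ideal_minimal_prime:
  assumes "minimal_prime P R" and disj: "P \<inter> U = {}"
  shows "minimal_prime (ext_ideal R U P) L"
proof -
  have P: "primeideal P R" using assms by (simp add: minimal_prime_def)
  note Pi = primeideal.axioms(1)[OF P]
  have "Q = ext_ideal R U P" if Q: "primeideal Q L" and sub: "Q \<subseteq> ext_ideal R U P" for Q
  proof -
    have "{a \<in> carrier R. loc_map R U a \<in> Q} \<subseteq> P"
      using loc_map_mem_ext_prime_iff[OF P disj] sub by blast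
    then have "{a \<in> carrier R. loc_map R U a \<in> Q} = P"
      using assms contraction_prime(1)[OF Q] by (auto simp: minimal_prime_def)
    then have "loc_map R U ` P \<subseteq> Q" by auto
    then have "ext_ideal R U P \<subseteq> Q"
      unfolding ext_ideal_def by (rule L.genideal_minimal[OF primeideal.axioms(1)[OF Q]])
    then show ?thesis using sub by simp
  qed
  then show ?thesis using ext_ideal_prime[OF P disj] by (auto simp: minimal_prime_def)
qed

end

section \<open>Reduction to minimal primes\<close>

context cring
begin

section \<open>Minimal primes of domains and of Noetherian rings\<close>

lemma minimal_prime_domain:
  assumes "domain R" "minimal_prime P R"
  shows "P = {\<zero>}"
proof -
  have P: "primeideal P R" "\<And>Q. primeideal Q R \<Longrightarrow> Q \<subseteq> P \<Longrightarrow> Q = P"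
    using assms(2) by (auto simp: minimal_prime_def)
  have "\<zero> \<in> P" by (rule additive_subgroup.zero_closed[OF ideal.axioms(1)[OF primeideal.axioms(1)[OF P(1)]]])
  then show ?thesis using P(2)[OF domain.zeroprimeideal[OF assms(1)]] by auto
qed

lemma adjoin_ideal:
  assumes I: "ideal I R" and a: "a \<in> carrier R"
  shows "ideal {i \<oplus> r \<otimes> a | i r. i \<in> I \<and> r \<in> carrier R} R" (is "ideal ?J R")
    and "I \<subseteq> {i \<oplus> r \<otimes> a | i r. i \<in> I \<and> r \<in> carrier R}"
    and "a \<in> {i \<oplus> r \<otimes> a | i r. i \<in> I \<and> r \<in> carrier R}"
proof -
  interpret I: ideal I R by fact
  show "ideal ?J R"
  proof (rule idealI_comm)
    show "?J \<subseteq> carrier R" using a by auto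
    have "\<zero> = \<zero> \<oplus> \<zero> \<otimes> a" using a by simp
    then show "\<zero> \<in> ?J" using I.zero_closed by blast
    fix x y assume "x \<in> ?J" "y \<in> ?J"
    then obtain i r j s where e: "x = i \<oplus> r \<otimes> a" "y = j \<oplus> s \<otimes> a" "i \<in> I" "j \<in> I" "r \<in> carrier R" "s \<in> carrier R"
      by blast
    then have "x \<oplus> y = (i \<oplus> j) \<oplus> (r \<oplus> s) \<otimes> a" using a by (simp add: l_distr a_ac)
    then show "x \<oplus> y \<in> ?J" using e by (blast intro: I.a_closed)
  next
    fix x t assume "x \<in> ?J" and t: "t \<in> carrier R"
    then obtain i r where e: "x = i \<oplus> r \<otimes> a" "i \<in> I" "r \<in> carrier R" by blast
    then have "t \<otimes> x = t \<otimes> i \<oplus> (t \<otimes> r) \<otimes> a" using a t by (simp add: r_distr m_assoc)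
    then show "t \<otimes> x \<in> ?J" using e t by (blast intro: I.I_l_closed)
  qed
  show "I \<subseteq> ?J"
  proof
    fix i assume "i \<in> I"
    then have "i = i \<oplus> \<zero> \<otimes> a" using a by simp
    then show "i \<in> ?J" using \<open>i \<in> I\<close> by blast
  qed
  have "a = \<zero> \<oplus> \<one> \<otimes> a" using a by simp
  then show "a \<in> ?J" using I.zero_closed by blast
qed

text \<open>By Noetherian induction: if \<open>a \<otimes> b \<in> I\<close> with neither factor in the ideal, the families for
  \<open>I + (a)\<close> and \<open>I + (b)\<close> combine. A set of primes with a uniform exponent replaces the usual
  product of primes contained in \<open>I\<close>.\<close>
lemma primes_over_ideal:
  assumes noeth: "noetherian_ring R" and "ideal I R"
  shows "\<exists>F n. finite F \<and> (\<forall>Q\<in>F. primeideal Q R) \<and>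
    (\<forall>P. primeideal P R \<and> I \<subseteq> P \<longrightarrow> (\<exists>Q\<in>F. Q \<subseteq> P)) \<and>
    (\<forall>x\<in>carrier R. (\<forall>Q\<in>F. x \<in> Q) \<longrightarrow> x [^] (n::nat) \<in> I)"
proof -
  define T where "T I \<longleftrightarrow> (\<exists>F n. finite F \<and> (\<forall>Q\<in>F. primeideal Q R) \<and>
    (\<forall>P. primeideal P R \<and> I \<subseteq> P \<longrightarrow> (\<exists>Q\<in>F. Q \<subseteq> P)) \<and>
    (\<forall>x\<in>carrier R. (\<forall>Q\<in>F. x \<in> Q) \<longrightarrow> x [^] (n::nat) \<in> I))" for I
  have "T I"
  proof (rule ccontr)
    assume "\<not> T I"
    define A where "A = {J. ideal J R \<and> \<not> T J}"
    have "\<exists>M\<in>A. \<forall>J\<in>A. M \<subseteq> J \<longrightarrow> J = M"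
    proof (rule subset_Zorn_nonempty)
      show "A \<noteq> {}" using \<open>\<not> T I\<close> assms by (auto simp: A_def)
      fix C assume "C \<noteq> {}" "subset.chain A C"
      \<comment> \<open>In a Noetherian ring the union of a nonempty chain of ideals belongs to the
        chain, so Zorn's lemma yields a maximal counterexample \<open>M\<close>.\<close>
      then have "\<Union> C \<in> C"
        by (intro noetherian_ring.ideal_chain_is_trivial[OF noeth]) (auto simp: A_def subset_chain_def)
      then show "\<Union> C \<in> A" using \<open>subset.chain A C\<close> by (auto simp: subset_chain_def)
    qed
    then obtain M where M: "ideal M R" "\<not> T M" "\<And>J. ideal J R \<Longrightarrow> M \<subset> J \<Longrightarrow> T J"
      unfolding A_def by blast
    interpret M: ideal M R by fact
    have "M \<noteq> carrier R"
    proof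
      assume eq: "M = carrier R"
      have "\<not> M \<subseteq> P" if "primeideal P R" for P
      proof -
        interpret P: primeideal P R by fact
        show ?thesis using P.I_notcarr P.a_subset eq by blast
      qed
      \<comment> \<open>No prime contains the whole ring, so the empty family suffices; any exponent
        would do, as every power lies in \<open>M\<close>.\<close>
      then have "T M" unfolding T_def eq
        by (intro exI[of _ "{}"] exI[of _ 0]) simp
      then show False using M by simp
    qed
    have notprime: "\<not> primeideal M R"
    proof
      assume "primeideal M R"
      then have "T M" unfolding T_def
        by (intro exI[of _ "{M}"] exI[of _ 1]) auto
      then show False using M by simp
    qed
    have "\<exists>a\<in>carrier R. \<exists>b\<in>carrier R. a \<otimes> b \<in> M \<and> a \<notin> M \<and> b \<notin> M"
    proof (rule ccontr)
      assume "\<not> ?thesis"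
      then have "primeideal M R"
        using \<open>M \<noteq> carrier R\<close> by (intro primeidealI M(1) is_cring) auto
      then show False using notprime by simp
    qed
    then obtain a b where ab: "a \<in> carrier R" "b \<in> carrier R" "a \<otimes> b \<in> M" "a \<notin> M" "b \<notin> M"
      by blast
    define Ma where "Ma c = {i \<oplus> r \<otimes> c | i r. i \<in> M \<and> r \<in> carrier R}" for c
    have T: "T (Ma c)" if "c \<in> carrier R" "c \<notin> M" for c
    proof (rule M(3))
      note adj = adjoin_ideal[OF M(1) that(1), folded Ma_def]
      show "ideal (Ma c) R" by (rule adj(1))
      show "M \<subset> Ma c" using adj(2,3) that(2) by blast
    qed
    obtain F n where F: "finite F" "\<forall>Q\<in>F. primeideal Q R"
        "\<forall>P. primeideal P R \<and> Ma a \<subseteq> P \<longrightarrow> (\<exists>Q\<in>F. Q \<subseteq> P)"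
        "\<forall>x\<in>carrier R. (\<forall>Q\<in>F. x \<in> Q) \<longrightarrow> x [^] (n::nat) \<in> Ma a"
      using T[OF ab(1,4)] unfolding T_def by (elim exE conjE) (rule that)
    obtain G m where G: "finite G" "\<forall>Q\<in>G. primeideal Q R"
        "\<forall>P. primeideal P R \<and> Ma b \<subseteq> P \<longrightarrow> (\<exists>Q\<in>G. Q \<subseteq> P)"
        "\<forall>x\<in>carrier R. (\<forall>Q\<in>G. x \<in> Q) \<longrightarrow> x [^] (m::nat) \<in> Ma b"
      using T[OF ab(2,5)] unfolding T_def by (elim exE conjE) (rule that)
    have sub: "Ma c \<subseteq> P" if "primeideal P R" "M \<subseteq> P" "c \<in> P" for c P
    proof -
      interpret P: primeideal P R by fact
      show ?thesis using that by (auto simp: Ma_def intro!: P.a_closed P.I_l_closed)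
    qed
    have "T M"
      unfolding T_def
    proof (intro exI[of _ "F \<union> G"] exI[of _ "n + m"] conjI ballI allI impI)
      fix P assume P: "primeideal P R \<and> M \<subseteq> P"
      then have "a \<in> P \<or> b \<in> P" using primeideal.I_prime[of P R a b] ab by auto
      then have "Ma a \<subseteq> P \<or> Ma b \<subseteq> P" using sub P by blast
      then have "(\<exists>Q\<in>F. Q \<subseteq> P) \<or> (\<exists>Q\<in>G. Q \<subseteq> P)" using F(3) G(3) P by blast
      then show "\<exists>Q\<in>F \<union> G. Q \<subseteq> P" by blast
    next
      fix x assume x: "x \<in> carrier R" "\<forall>Q\<in>F \<union> G. x \<in> Q"
      then have "x [^] n \<in> Ma a" "x [^] m \<in> Ma b" using F(4) G(4) by auto
      then obtain i r j s where e: "x [^] n = i \<oplus> r \<otimes> a" "x [^] m = j \<oplus> s \<otimes> b"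
        "i \<in> M" "j \<in> M" "r \<in> carrier R" "s \<in> carrier R"
        unfolding Ma_def by auto
      have "x [^] (n + m) = x [^] n \<otimes> x [^] m" using x by (simp add: nat_pow_mult)
      \<comment> \<open>Each summand has \<open>i\<close>, \<open>j\<close> or
        \<open>a \<otimes> b\<close> as a factor, and these lie in \<open>M\<close>.\<close>
      also have "\<dots> = i \<otimes> (j \<oplus> s \<otimes> b) \<oplus> ((r \<otimes> a) \<otimes> j \<oplus> (r \<otimes> s) \<otimes> (a \<otimes> b))"
        unfolding e using e ab by (simp add: l_distr r_distr m_ac a_ac)
      also have "\<dots> \<in> M" using e ab by (simp add: M.a_closed M.I_l_closed M.I_r_closed)
      finally show "x [^] (n + m) \<in> M" .
    qed (use F G in auto)
    then show False using M by simp
  qed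
  then show ?thesis by (simp add: T_def)
qed

text \<open>The family \<open>F\<close> for the zero ideal contains every minimal prime, since each
  prime has a member of \<open>F\<close> below it. Each member of \<open>F\<close> contains a
  minimal prime, so an element of all minimal primes lies in all members of
  \<open>F\<close>.\<close>

lemma noetherian_minimal_primes:
  assumes noeth: "noetherian_ring R"
  shows "finite {P. minimal_prime P R}"
    and "\<exists>n::nat. \<forall>x\<in>carrier R. (\<forall>P. minimal_prime P R \<longrightarrow> x \<in> P) \<longrightarrow> x [^] n = \<zero>"
proof -
  obtain F n where F: "finite F" "\<forall>Q\<in>F. primeideal Q R"
    "\<forall>P. primeideal P R \<and> {\<zero>} \<subseteq> P \<longrightarrow> (\<exists>Q\<in>F. Q \<subseteq> P)"
    "\<forall>x\<in>carrier R. (\<forall>Q\<in>F. x \<in> Q) \<longrightarrow> x [^] (n::nat) \<in> {\<zero>}"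
    using primes_over_ideal[OF noeth zeroideal] by (elim exE conjE) (rule that)
  have contains: "\<exists>Q\<in>F. Q \<subseteq> P" if "primeideal P R" for P
  proof -
    have "\<zero> \<in> P"
      by (rule additive_subgroup.zero_closed[OF ideal.axioms(1)[OF primeideal.axioms(1)[OF that]]])
    then show ?thesis using F(3) that by simp
  qed
  have "P \<in> F" if P: "minimal_prime P R" for P
  proof -
    obtain Q where "Q \<in> F" "Q \<subseteq> P" using contains[of P] P by (auto simp: minimal_prime_def)
    then show ?thesis using P F(2) by (auto simp: minimal_prime_def)
  qed
  then have "{P. minimal_prime P R} \<subseteq> F" by blast
  then show "finite {P. minimal_prime P R}" using F(1) finite_subset by blast
  have min: "\<exists>P. minimal_prime P R \<and> P \<subseteq> Q" if QF: "Q \<in> F" for Q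
  proof -
    \<comment> \<open>A minimal member of \<open>F\<close> is a minimal prime: any prime below it
      contains a member of \<open>F\<close>, which must be that same member.\<close>
    obtain P where P: "P \<in> F" "P \<subseteq> Q" "\<And>P'. P' \<in> F \<Longrightarrow> P' \<subseteq> P \<Longrightarrow> P = P'"
      using finite_has_minimal2[OF F(1) QF] by auto
    have "minimal_prime P R"
      unfolding minimal_prime_def
    proof (intro conjI allI impI)
      fix P' assume P': "primeideal P' R \<and> P' \<subseteq> P"
      then obtain Q' where "Q' \<in> F" "Q' \<subseteq> P'" using contains by blast
      then show "P' = P" using P(3)[of Q'] P' by blast
    qed (use F P in blast)
    then show ?thesis using P by blast
  qed
  show "\<exists>n::nat. \<forall>x\<in>carrier R. (\<forall>P. minimal_prime P R \<longrightarrow> x \<in> P) \<longrightarrow> x [^] n = \<zero>"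
  proof (intro exI[of _ n] ballI impI)
    fix x assume x: "x \<in> carrier R" "\<forall>P. minimal_prime P R \<longrightarrow> x \<in> P"
    then have "\<forall>Q\<in>F. x \<in> Q" using min by blast
    then show "x [^] n = \<zero>" using F(4) x by simp
  qed
qed

text \<open>For each \<open>Q\<close> an element outside \<open>P\<close> is picked; the product
  lies in every \<open>Q\<close>, and primality keeps it outside \<open>P\<close>.\<close>

lemma prime_avoidance_element:
  assumes P: "primeideal P R" and "finite N" "\<And>Q. Q \<in> N \<Longrightarrow> primeideal Q R \<and> \<not> Q \<subseteq> P"
  shows "\<exists>d\<in>carrier R. d \<notin> P \<and> (\<forall>Q\<in>N. d \<in> Q)"
  using assms(2,3)
proof (induction N rule: finite_induct)
  case empty
  interpret P: primeideal P R by fact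
  show ?case using P.I_notcarr P.one_imp_carrier by (intro bexI[of _ \<one>]) auto
next
  case (insert Q N)
  then obtain d where d: "d \<in> carrier R" "d \<notin> P" "\<And>Q'. Q' \<in> N \<Longrightarrow> d \<in> Q'" by auto
  obtain a where a: "a \<in> Q" "a \<notin> P" using insert.prems by auto
  have ideals: "ideal Q' R" if "Q' \<in> insert Q N" for Q'
    using insert.prems[OF that] primeideal.axioms(1) by blast
  have ac: "a \<in> carrier R" using ideal.Icarr[OF ideals a(1)] by simp
  show ?case
  proof (intro bexI[of _ "a \<otimes> d"] conjI ballI)
    show "a \<otimes> d \<notin> P" using primeideal.I_prime[OF P ac d(1)] a d by blast
    fix Q' assume "Q' \<in> insert Q N"
    then show "a \<otimes> d \<in> Q'"
      using ideal.I_l_closed[OF ideals] ideal.I_r_closed[OF ideals] a d ac by auto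
  qed (use ac d in auto)
qed

text \<open>By \<open>frobenius_preimage_ideal\<close> with multiplier \<open>\<one>\<close> it
  suffices to look at generators, where the exponents multiply.\<close>

lemma frob_power_frobenius:
  assumes p: "has_char R p" and I: "I \<subseteq> carrier R" and k: "k \<in> frob_power R I (p ^ e)"
  shows "k [^] (p ^ e') \<in> frob_power R I (p ^ (e + e'))"
proof -
  have "ideal {y \<in> carrier R. \<one> \<otimes> y [^] (p ^ e') \<in> frob_power R I (p ^ (e + e'))} R"
    by (rule frobenius_preimage_ideal[OF p frob_power_ideal[OF I]]) simp
  moreover have "(\<lambda>x. x [^] (p ^ e)) ` I \<subseteq> {y \<in> carrier R. \<one> \<otimes> y [^] (p ^ e') \<in> frob_power R I (p ^ (e + e'))}"
    using I pow_mem_frob_power[OF I] by (auto simp: nat_pow_pow power_add subset_iff)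
  ultimately have "frob_power R I (p ^ e) \<subseteq> {y \<in> carrier R. \<one> \<otimes> y [^] (p ^ e') \<in> frob_power R I (p ^ (e + e'))}"
    unfolding frob_power_def[of _ _ "p ^ e"] by (rule genideal_minimal)
  then show ?thesis using k by auto
qed

text \<open>The image of \<open>y\<close> lies in the tight closure of the image of \<open>I\<close> in \<open>R/P\<close>, written upstairs
  in \<open>R\<close>; membership in \<open>I\<^sup>[\<^sup>q\<^sup>] + P\<close> is expressed by the witness \<open>k\<close>.\<close>
definition tight_modulo :: "nat \<Rightarrow> 'a set \<Rightarrow> 'a set \<Rightarrow> 'a \<Rightarrow> bool" where
  "tight_modulo p I P y \<longleftrightarrow> (\<exists>c\<in>carrier R. c \<notin> P \<and>
    (\<exists>e0. \<forall>e\<ge>e0. \<exists>k\<in>frob_power R I (p ^ e). c \<otimes> y [^] (p ^ e) \<ominus> k \<in> P))"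

text \<open>The multiplier \<open>c\<close> is kept and the witness \<open>k\<close> becomes
  \<open>a [^] (p ^ e) \<otimes> k\<close>. This allows factors from \<open>U\<close> found for
  different primes to be multiplied together.\<close>

lemma tight_modulo_mult:
  assumes I: "I \<subseteq> carrier R" and P: "ideal P R" and y: "y \<in> carrier R" and a: "a \<in> carrier R"
    and G: "tight_modulo p I P y"
  shows "tight_modulo p I P (a \<otimes> y)"
proof -
  interpret P: ideal P R by fact
  obtain c e0 where c: "c \<in> carrier R" "c \<notin> P"
    "\<forall>e\<ge>e0. \<exists>k\<in>frob_power R I (p ^ e). c \<otimes> y [^] (p ^ e) \<ominus> k \<in> P"
    using G unfolding tight_modulo_def by (elim conjE bexE exE) (rule that)
  have "\<exists>k\<in>frob_power R I (p ^ e). c \<otimes> (a \<otimes> y) [^] (p ^ e) \<ominus> k \<in> P" if e: "e0 \<le> e" for e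
  proof -
    interpret F: ideal "frob_power R I (p ^ e)" R by (rule frob_power_ideal[OF I])
    obtain k where k: "k \<in> frob_power R I (p ^ e)" "c \<otimes> y [^] (p ^ e) \<ominus> k \<in> P"
      using c(3)[rule_format, OF e] by (elim bexE) (rule that)
    have kc: "k \<in> carrier R" using k(1) by simp
    have "c \<otimes> (a \<otimes> y) [^] (p ^ e) \<ominus> a [^] (p ^ e) \<otimes> k = a [^] (p ^ e) \<otimes> (c \<otimes> y [^] (p ^ e) \<ominus> k)"
      using kc c(1) a y by (simp add: minus_eq r_distr l_minus r_minus nat_pow_distrib m_ac)
    also have "\<dots> \<in> P" by (rule P.I_l_closed[OF k(2) nat_pow_closed[OF a]])
    finally show ?thesis
      by (rule bexI[OF _ F.I_l_closed[OF k(1) nat_pow_closed[OF a]]])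
  qed
  then show ?thesis unfolding tight_modulo_def
    by (intro bexI[OF _ c(1)] conjI c(2) exI[of _ e0] allI impI)
qed

text \<open>Multiplier \<open>\<one>\<close> and witness \<open>\<zero>\<close> suffice;
  \<open>p > 0\<close> makes the exponent positive, so the power of \<open>y\<close> stays in
  \<open>P\<close>. This serves the minimal primes meeting \<open>U\<close>.\<close>

lemma tight_modulo_of_mem:
  assumes I: "I \<subseteq> carrier R" and P: "primeideal P R" and y: "y \<in> P" and p: "p > 0"
  shows "tight_modulo p I P y"
proof -
  interpret P: primeideal P R by fact
  have "\<one> \<notin> P" using P.I_notcarr P.one_imp_carrier by blast
  moreover have "\<exists>k\<in>frob_power R I (p ^ e). \<one> \<otimes> y [^] (p ^ e) \<ominus> k \<in> P" for e
  proof -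
    interpret F: ideal "frob_power R I (p ^ e)" R by (rule frob_power_ideal[OF I])
    obtain m where m: "p ^ e = Suc m" using p by (metis gr0_implies_Suc zero_less_power)
    have "y [^] (p ^ e) \<in> P" unfolding m nat_pow_Suc
      using y by (intro P.I_l_closed) simp_all
    then show ?thesis using y by (intro bexI[OF _ F.zero_closed]) (simp add: minus_eq)
  qed
  ultimately show ?thesis unfolding tight_modulo_def
    by (intro bexI[OF _ one_closed] conjI exI[of _ 0] allI impI)
qed

lemma tight_closure_modulo_minimal_primes:
  assumes noeth: "noetherian_ring R" and p: "has_char R p" and I: "I \<subseteq> carrier R" and y: "y \<in> carrier R"
    and loc: "\<And>P. minimal_prime P R \<Longrightarrow> tight_modulo p I P y"
  shows "y \<in> tight_closure p R I"
proof -
  define M where "M = {P. minimal_prime P R}"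
  have fin: "finite M" unfolding M_def by (rule noetherian_minimal_primes[OF noeth])
  have prime: "primeideal P R" if "P \<in> M" for P using that by (simp add: M_def minimal_prime_def)
  note id = prime[THEN primeideal.axioms(1)]
  note zero = additive_subgroup.zero_closed[OF ideal.axioms(1)]
  note Fi = frob_power_ideal[OF I]
  \<comment> \<open>To add \<open>P\<close> to \<open>N\<close>, add to \<open>c\<close> a multiplier for \<open>P\<close> times an element lying in exactly the
    minimal primes other than \<open>P\<close>. For \<open>N = M\<close> the error is nilpotent and a Frobenius power kills it.\<close>
  have "\<exists>c\<in>carrier R. (\<forall>P\<in>N. c \<notin> P) \<and> (\<forall>P\<in>M - N. c \<in> P) \<and>
      (\<exists>e0. \<forall>e\<ge>e0. \<exists>k\<in>frob_power R I (p ^ e). \<forall>P\<in>M. c \<otimes> y [^] (p ^ e) \<ominus> k \<in> P)"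
    if "finite N" "N \<subseteq> M" for N
    using that
  proof (induction N rule: finite_induct)
    case empty
    \<comment> \<open>The induction starts from the multiplier \<open>\<zero>\<close>, which lies in
      all minimal primes and leaves no error.\<close>
    have "\<exists>k\<in>frob_power R I (p ^ e). \<forall>P\<in>M. \<zero> \<otimes> y [^] (p ^ e) \<ominus> k \<in> P" for e
      using y zero[OF id] by (intro bexI[OF _ zero[OF Fi]]) (simp add: minus_eq)
    then have "\<exists>e0. \<forall>e\<ge>e0. \<exists>k\<in>frob_power R I (p ^ e). \<forall>P\<in>M. \<zero> \<otimes> y [^] (p ^ e) \<ominus> k \<in> P"
      by blast
    moreover have "\<forall>P\<in>M - {}. \<zero> \<in> P" using zero[OF id] by simp
    ultimately show ?case by (intro bexI[of _ \<zero>] conjI) (simp_all only: ball_empty zero_closed)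
  next
    case (insert P N)
    have PM: "P \<in> M" using insert by auto
    interpret P: primeideal P R by (rule prime[OF PM])
    have NM: "N \<subseteq> M" using insert.prems by simp
    obtain c e1 where c: "c \<in> carrier R" "\<forall>Q\<in>N. c \<notin> Q" "\<forall>Q\<in>M - N. c \<in> Q"
      "\<forall>e\<ge>e1. \<exists>k\<in>frob_power R I (p ^ e). \<forall>P\<in>M. c \<otimes> y [^] (p ^ e) \<ominus> k \<in> P"
      using insert.IH[OF NM] by (elim exE conjE bexE) (rule that)
    have mP: "minimal_prime P R" using PM by (simp add: M_def)
    obtain b e2 where b: "b \<in> carrier R" "b \<notin> P"
      "\<forall>e\<ge>e2. \<exists>k\<in>frob_power R I (p ^ e). b \<otimes> y [^] (p ^ e) \<ominus> k \<in> P"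
      using loc[OF mP] unfolding tight_modulo_def by (elim exE conjE bexE) (rule that)
    have "\<exists>d\<in>carrier R. d \<notin> P \<and> (\<forall>Q\<in>M - {P}. d \<in> Q)"
    proof (rule prime_avoidance_element[OF P.primeideal])
      fix Q assume Q: "Q \<in> M - {P}"
      then have "primeideal Q R" using prime by simp
      moreover have "\<not> Q \<subseteq> P"
        using mP \<open>primeideal Q R\<close> Q unfolding minimal_prime_def by blast
      ultimately show "primeideal Q R \<and> \<not> Q \<subseteq> P" by simp
    qed (use fin in simp)
    then obtain d where d: "d \<in> carrier R" "d \<notin> P" "\<forall>Q\<in>M - {P}. d \<in> Q"
      by (elim exE conjE bexE) (rule that)
    have db: "d \<otimes> b \<in> carrier R" "d \<otimes> b \<notin> P" using P.I_prime[OF d(1) b(1)] b(1,2) d(1,2) by auto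
    have dbQ: "d \<otimes> b \<in> Q" if "Q \<in> M - {P}" for Q
    proof -
      have "d \<in> Q" using d(3) that by simp
      then show ?thesis using ideal.I_r_closed[OF id _ b(1)] that by simp
    qed
    \<comment> \<open>Used contrapositively: an element of \<open>Q\<close> plus one outside
      \<open>Q\<close> is outside \<open>Q\<close>. For \<open>Q = P\<close> the summand inside is
      \<open>c\<close>, for \<open>Q\<close> in \<open>N\<close> it is
      \<open>d \<otimes> b\<close>.\<close>
    have cancel: "s \<in> Q" if "Q \<in> M" "r \<in> Q" "r \<oplus> s \<in> Q" "s \<in> carrier R" for Q r s
    proof -
      interpret Q: ideal Q R by (rule id[OF that(1)])
      have "\<ominus> r \<oplus> (r \<oplus> s) \<in> Q" by (rule Q.a_closed[OF Q.a_inv_closed[OF that(2)] that(3)])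
      moreover have "\<ominus> r \<oplus> (r \<oplus> s) = s"
        using Q.Icarr[OF that(2)] that(4) by (simp add: a_assoc[symmetric] l_neg)
      ultimately show ?thesis by simp
    qed
    show ?case
    proof (rule bexI[of _ "c \<oplus> d \<otimes> b"], intro conjI ballI exI[of _ "max e1 e2"] allI impI)
      fix Q assume Q: "Q \<in> insert P N"
      show "c \<oplus> d \<otimes> b \<notin> Q"
      proof (cases "Q = P")
        case True
        have "c \<in> P" using c(3) PM insert.hyps by simp
        then show ?thesis using cancel[OF PM _ _ db(1)] db(2) True by blast
      next
        case False
        then have QN: "Q \<in> N" "Q \<in> M" using Q insert.prems by auto
        then have "d \<otimes> b \<in> Q" using dbQ False by simp
        moreover have "c \<notin> Q" using c(2) QN by simp
        ultimately show ?thesis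
          using cancel[OF QN(2) _ _ c(1), of "d \<otimes> b"] a_comm[OF c(1) db(1)] by auto
      qed
    next
      fix Q assume Q: "Q \<in> M - insert P N"
      then have "c \<in> Q" "d \<otimes> b \<in> Q" "Q \<in> M" using c(3) dbQ by simp_all
      then show "c \<oplus> d \<otimes> b \<in> Q"
        using additive_subgroup.a_closed[OF ideal.axioms(1)[OF id]] by blast
    next
      fix e assume "max e1 e2 \<le> e"
      then have e: "e1 \<le> e" "e2 \<le> e" by auto
      from c(4) e(1) obtain k where k: "k \<in> frob_power R I (p ^ e)" "\<forall>Q\<in>M. c \<otimes> y [^] (p ^ e) \<ominus> k \<in> Q"
        by auto
      from b(3) e(2) obtain l where l: "l \<in> frob_power R I (p ^ e)" "b \<otimes> y [^] (p ^ e) \<ominus> l \<in> P"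
        by auto
      interpret F: ideal "frob_power R I (p ^ e)" R by (rule Fi)
      have carr: "k \<in> carrier R" "l \<in> carrier R" using k l by auto
      show "\<exists>k\<in>frob_power R I (p ^ e). \<forall>P\<in>M. (c \<oplus> d \<otimes> b) \<otimes> y [^] (p ^ e) \<ominus> k \<in> P"
      proof (intro bexI[of _ "k \<oplus> d \<otimes> l"] ballI)
        show "k \<oplus> d \<otimes> l \<in> frob_power R I (p ^ e)" using k(1) l(1) d(1) by (simp add: F.a_closed F.I_l_closed)
        fix Q assume Q: "Q \<in> M"
        interpret Q: ideal Q R by (rule id[OF Q])
        \<comment> \<open>The error is the old one, in every minimal prime, plus \<open>d\<close>
          times the error for \<open>P\<close>; the latter lies in \<open>P\<close> by the choice of
          \<open>l\<close> and in the other minimal primes by the choice of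
          \<open>d\<close>.\<close>
        have "(c \<oplus> d \<otimes> b) \<otimes> y [^] (p ^ e) \<ominus> (k \<oplus> d \<otimes> l)
          = (c \<otimes> y [^] (p ^ e) \<ominus> k) \<oplus> d \<otimes> (b \<otimes> y [^] (p ^ e) \<ominus> l)"
          using carr c(1) d(1) b(1) y by (simp add: minus_eq minus_add r_minus l_distr r_distr a_ac m_ac)
        moreover have "d \<otimes> (b \<otimes> y [^] (p ^ e) \<ominus> l) \<in> Q"
        proof (cases "Q = P")
          case True
          then show ?thesis using l(2) d(1) P.I_l_closed by simp
        next
          case False
          then have "d \<in> Q" using Q d(3) by simp
          then show ?thesis using b(1) y carr by (intro Q.I_r_closed) simp_all
        qed
        ultimately show "(c \<oplus> d \<otimes> b) \<otimes> y [^] (p ^ e) \<ominus> (k \<oplus> d \<otimes> l) \<in> Q"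
          using k(2) Q by (simp add: Q.a_closed)
      qed
    qed (use c(1) db(1) in simp)
  qed
  from this[OF fin order.refl] obtain c e0 where c: "c \<in> carrier R" "\<forall>P\<in>M. c \<notin> P"
    "\<forall>e\<ge>e0. \<exists>k\<in>frob_power R I (p ^ e). \<forall>P\<in>M. c \<otimes> y [^] (p ^ e) \<ominus> k \<in> P"
    by (elim exE conjE bexE) (rule that)
  obtain n :: nat where n: "\<And>x. x \<in> carrier R \<Longrightarrow> (\<forall>P\<in>M. x \<in> P) \<Longrightarrow> x [^] n = \<zero>"
    using noetherian_minimal_primes(2)[OF noeth] by (auto simp: M_def)
  have "p > 1" using p prime_gt_1_nat by (auto simp: has_char_def)
  \<comment> \<open>The nilpotency exponent \<open>n\<close> is enlarged to \<open>p ^ n\<close>,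
    since raising to a power of \<open>p\<close> is additive.\<close>
  then have ne: "n \<le> p ^ n" using less_exp[of n] power_mono[of 2 p n] by linarith
  have nil: "x [^] (p ^ n) = \<zero>" if "x \<in> carrier R" "\<forall>P\<in>M. x \<in> P" for x
  proof -
    have "x [^] (p ^ n) = x [^] n \<otimes> x [^] (p ^ n - n)" using that ne by (simp add: nat_pow_mult)
    then show ?thesis using n[OF that] that by simp
  qed
  \<comment> \<open>The final multiplier is \<open>c [^] (p ^ n)\<close>; the threshold moves to
    \<open>e0 + n\<close> because \<open>n\<close> Frobenius steps are spent on killing the
    error.\<close>
  have "c [^] (p ^ n) \<otimes> y [^] (p ^ e) \<in> frob_power R I (p ^ e)" if "e \<ge> e0 + n" for e
  proof -
    define e1 where "e1 = e - n"
    have e: "e = e1 + n" "e1 \<ge> e0" using that by (auto simp: e1_def)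
    obtain k where k: "k \<in> frob_power R I (p ^ e1)" "\<forall>P\<in>M. c \<otimes> y [^] (p ^ e1) \<ominus> k \<in> P"
      using c(3) e(2) by auto
    have kc: "k \<in> carrier R" using ideal.Icarr[OF Fi k(1)] .
    have "c [^] (p ^ n) \<otimes> y [^] (p ^ e) = (c \<otimes> y [^] (p ^ e1)) [^] (p ^ n)"
      using c(1) y by (simp add: nat_pow_distrib nat_pow_pow e power_add)
    also have "c \<otimes> y [^] (p ^ e1) = (c \<otimes> y [^] (p ^ e1) \<ominus> k) \<oplus> k"
      using c(1) y kc by (simp add: minus_eq a_assoc l_neg)
    also have "\<dots> [^] (p ^ n) = (c \<otimes> y [^] (p ^ e1) \<ominus> k) [^] (p ^ n) \<oplus> k [^] (p ^ n)"
      using c(1) y kc by (intro freshmans_dream_pow[OF p]) auto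
    also have "\<dots> = k [^] (p ^ n)" using c(1) y kc nil[OF _ k(2)] by simp
    also have "\<dots> \<in> frob_power R I (p ^ e)" unfolding e(1) by (rule frob_power_frobenius[OF p I k(1)])
    finally show ?thesis .
  qed
  moreover have "c [^] (p ^ n) \<notin> P" if "minimal_prime P R" for P
    using prime_pow_notin[OF prime c(1)] c(2) that by (auto simp: M_def)
  ultimately show ?thesis using c(1) y unfolding tight_closure_def by blast
qed

end

section \<open>Linear functionals on extension domains\<close>

locale domain_extension = ring_hom_cring R S h + dR: domain R + dS: domain S
  for R (structure) and S (structure) and h +
  assumes h_inj: "inj_on h (carrier R)"
begin

lemma h_eq_zero: "\<lbrakk>b \<in> carrier R; h b = \<zero>\<^bsub>S\<^esub>\<rbrakk> \<Longrightarrow> b = \<zero>"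
  using inj_onD[OF h_inj, of b \<zero>] by simp

text \<open>\<open>S\<close> is an \<open>R\<close>-module through \<open>h\<close>. The domain
  \<open>M\<close> is an explicit set so that a functional can be enlarged one generator at a time;
  any element of \<open>M\<close> puts zero into \<open>M\<close>, as its multiple by
  \<open>\<zero>\<close>.\<close>

definition functional_on :: "'c set \<Rightarrow> ('c \<Rightarrow> 'a) \<Rightarrow> bool" where
  "functional_on M \<theta> \<longleftrightarrow> M \<subseteq> carrier S \<and> (\<forall>m\<in>M. \<theta> m \<in> carrier R) \<and>
    (\<forall>m\<in>M. \<forall>n\<in>M. m \<oplus>\<^bsub>S\<^esub> n \<in> M \<and> \<theta> (m \<oplus>\<^bsub>S\<^esub> n) = \<theta> m \<oplus> \<theta> n) \<and>
    (\<forall>b\<in>carrier R. \<forall>m\<in>M. h b \<otimes>\<^bsub>S\<^esub> m \<in> M \<and> \<theta> (h b \<otimes>\<^bsub>S\<^esub> m) = b \<otimes> \<theta> m)"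

lemma functional_onD:
  assumes "functional_on M \<theta>"
  shows "m \<in> M \<Longrightarrow> m \<in> carrier S"
    and "m \<in> M \<Longrightarrow> \<theta> m \<in> carrier R"
    and "\<lbrakk>m \<in> M; n \<in> M\<rbrakk> \<Longrightarrow> m \<oplus>\<^bsub>S\<^esub> n \<in> M"
    and "\<lbrakk>m \<in> M; n \<in> M\<rbrakk> \<Longrightarrow> \<theta> (m \<oplus>\<^bsub>S\<^esub> n) = \<theta> m \<oplus> \<theta> n"
    and "\<lbrakk>b \<in> carrier R; m \<in> M\<rbrakk> \<Longrightarrow> h b \<otimes>\<^bsub>S\<^esub> m \<in> M"
    and "\<lbrakk>b \<in> carrier R; m \<in> M\<rbrakk> \<Longrightarrow> \<theta> (h b \<otimes>\<^bsub>S\<^esub> m) = b \<otimes> \<theta> m"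
  using assms unfolding functional_on_def by (simp_all add: subset_iff)

text \<open>Since \<open>h\<close> is injective and \<open>S\<close> is a domain, multiples of
  \<open>d\<close> have unique coefficients; reading off the coefficient is a functional with value
  \<open>\<one>\<close> at \<open>d\<close>.\<close>

lemma functional_on_line:
  assumes d: "d \<in> carrier S" "d \<noteq> \<zero>\<^bsub>S\<^esub>"
  shows "\<exists>M \<theta>. functional_on M \<theta> \<and> d \<in> M \<and> \<theta> d \<noteq> \<zero>"
proof -
  define g where "g b = h b \<otimes>\<^bsub>S\<^esub> d" for b
  define M where "M = g ` carrier R"
  define \<theta> where "\<theta> = inv_into (carrier R) g"
  have inj: "inj_on g (carrier R)"
  proof (rule inj_onI)
    fix a b assume ab: "a \<in> carrier R" "b \<in> carrier R" "g a = g b"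
    then have "h a = h b" using d dS.m_rcancel[of d "h a" "h b"] by (simp add: g_def)
    then show "a = b" using inj_onD[OF h_inj] ab by blast
  qed
  have \<theta>: "\<theta> (g b) = b" if "b \<in> carrier R" for b
    unfolding \<theta>_def by (rule inv_into_f_f[OF inj that])
  have add: "g a \<oplus>\<^bsub>S\<^esub> g b = g (a \<oplus> b)" and mult: "h a \<otimes>\<^bsub>S\<^esub> g b = g (a \<otimes> b)"
    if "a \<in> carrier R" "b \<in> carrier R" for a b
    using that d by (simp_all add: g_def S.l_distr S.m_assoc)
  have "functional_on M \<theta>"
    unfolding functional_on_def M_def
  proof (intro conjI ballI)
    show "g ` carrier R \<subseteq> carrier S" using d by (auto simp: g_def)
  qed (auto simp: \<theta> add mult)
  moreover have "g \<one> = d" using d by (simp add: g_def)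
  then have "d \<in> M" "\<theta> d = \<one>" using \<theta>[of \<one>] by (auto simp: M_def intro!: image_eqI[of _ _ \<one>])
  ultimately show ?thesis by (intro exI[of _ M] exI[of _ \<theta>]) simp
qed

text \<open>If some nonzero multiple \<open>b x\<close> lies in \<open>M\<close>, then \<open>s \<mapsto> \<theta> (b s)\<close> works on \<open>M + R x\<close>; otherwise that
  sum is direct and \<open>\<theta>\<close> can be extended by zero.\<close>
lemma functional_on_extend:
  assumes M: "functional_on M \<theta>" and d: "d \<in> M" "\<theta> d \<noteq> \<zero>" and x: "x \<in> carrier S"
  shows "\<exists>M' \<theta>'. functional_on M' \<theta>' \<and> d \<in> M' \<and> \<theta>' d \<noteq> \<zero> \<and> M \<subseteq> M' \<and> x \<in> M'"
proof -
  note MD = functional_onD[OF M]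
  define M' where "M' = {m \<oplus>\<^bsub>S\<^esub> h a \<otimes>\<^bsub>S\<^esub> x | m a. m \<in> M \<and> a \<in> carrier R}"
  have M'I: "m \<oplus>\<^bsub>S\<^esub> h a \<otimes>\<^bsub>S\<^esub> x \<in> M'" if "m \<in> M" "a \<in> carrier R" for m a
    using that unfolding M'_def by blast
  have M'E: "\<exists>m a. m \<in> M \<and> a \<in> carrier R \<and> s = m \<oplus>\<^bsub>S\<^esub> h a \<otimes>\<^bsub>S\<^esub> x" if "s \<in> M'" for s
    using that unfolding M'_def by blast
  have zero: "\<zero>\<^bsub>S\<^esub> \<in> M" using MD(5)[OF R.zero_closed d(1)] MD(1)[OF d(1)] by simp
  have sub: "M \<subseteq> M'"
  proof
    fix m assume m: "m \<in> M"
    then show "m \<in> M'" using M'I[OF m R.zero_closed] x MD(1)[OF m] by simp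
  qed
  have xM': "x \<in> M'" using M'I[OF zero R.one_closed] x by simp
  have M'car: "s \<in> carrier S" if "s \<in> M'" for s using M'E[OF that] MD(1) x by auto
  have add: "(m \<oplus>\<^bsub>S\<^esub> h a \<otimes>\<^bsub>S\<^esub> x) \<oplus>\<^bsub>S\<^esub> (n \<oplus>\<^bsub>S\<^esub> h b \<otimes>\<^bsub>S\<^esub> x) = (m \<oplus>\<^bsub>S\<^esub> n) \<oplus>\<^bsub>S\<^esub> h (a \<oplus> b) \<otimes>\<^bsub>S\<^esub> x"
    if "m \<in> M" "n \<in> M" "a \<in> carrier R" "b \<in> carrier R" for m n a b
    using that x MD(1) by (simp add: S.l_distr S.a_ac)
  have mult: "h b \<otimes>\<^bsub>S\<^esub> (m \<oplus>\<^bsub>S\<^esub> h a \<otimes>\<^bsub>S\<^esub> x) = h b \<otimes>\<^bsub>S\<^esub> m \<oplus>\<^bsub>S\<^esub> h (b \<otimes> a) \<otimes>\<^bsub>S\<^esub> x"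
    if "m \<in> M" "a \<in> carrier R" "b \<in> carrier R" for m a b
    using that x MD(1) by (simp add: S.r_distr S.m_assoc)
  have addM': "s \<oplus>\<^bsub>S\<^esub> t \<in> M'" if st: "s \<in> M'" "t \<in> M'" for s t
  proof -
    obtain m a where s: "m \<in> M" "a \<in> carrier R" "s = m \<oplus>\<^bsub>S\<^esub> h a \<otimes>\<^bsub>S\<^esub> x" using M'E[OF st(1)] by blast
    obtain n b where t: "n \<in> M" "b \<in> carrier R" "t = n \<oplus>\<^bsub>S\<^esub> h b \<otimes>\<^bsub>S\<^esub> x" using M'E[OF st(2)] by blast
    show ?thesis unfolding s(3) t(3) add[OF s(1) t(1) s(2) t(2)]
      by (rule M'I[OF MD(3)[OF s(1) t(1)] R.a_closed[OF s(2) t(2)]])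
  qed
  have multM': "h b \<otimes>\<^bsub>S\<^esub> s \<in> M'" if st: "b \<in> carrier R" "s \<in> M'" for s b
  proof -
    obtain m a where s: "m \<in> M" "a \<in> carrier R" "s = m \<oplus>\<^bsub>S\<^esub> h a \<otimes>\<^bsub>S\<^esub> x" using M'E[OF st(2)] by blast
    show ?thesis unfolding s(3) mult[OF s(1,2) st(1)]
      by (rule M'I[OF MD(5)[OF st(1) s(1)] R.m_closed[OF st(1) s(2)]])
  qed
  show ?thesis
  proof (cases "\<exists>b\<in>carrier R. b \<noteq> \<zero> \<and> h b \<otimes>\<^bsub>S\<^esub> x \<in> M")
    case True
    then obtain b where b: "b \<in> carrier R" "b \<noteq> \<zero>" "h b \<otimes>\<^bsub>S\<^esub> x \<in> M" by blast
    have bM: "h b \<otimes>\<^bsub>S\<^esub> s \<in> M" if sM: "s \<in> M'" for s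
    proof -
      obtain m a where s: "m \<in> M" "a \<in> carrier R" "s = m \<oplus>\<^bsub>S\<^esub> h a \<otimes>\<^bsub>S\<^esub> x" using M'E[OF sM] by blast
      have "h b \<otimes>\<^bsub>S\<^esub> s = h b \<otimes>\<^bsub>S\<^esub> m \<oplus>\<^bsub>S\<^esub> h a \<otimes>\<^bsub>S\<^esub> (h b \<otimes>\<^bsub>S\<^esub> x)"
        using s b x MD(1) by (simp add: S.r_distr S.m_ac)
      then show ?thesis using MD(3)[OF MD(5)[OF b(1) s(1)] MD(5)[OF s(2) b(3)]] by simp
    qed
    define \<theta>' where "\<theta>' s = \<theta> (h b \<otimes>\<^bsub>S\<^esub> s)" for s
    have "functional_on M' \<theta>'"
      unfolding functional_on_def
    proof (intro conjI ballI subsetI)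
      fix s t assume st: "s \<in> M'" "t \<in> M'"
      show "\<theta>' (s \<oplus>\<^bsub>S\<^esub> t) = \<theta>' s \<oplus> \<theta>' t"
        using MD(4)[OF bM[OF st(1)] bM[OF st(2)]] st[THEN M'car] b(1) by (simp add: \<theta>'_def S.r_distr)
    next
      fix a s assume as: "a \<in> carrier R" "s \<in> M'"
      have "h b \<otimes>\<^bsub>S\<^esub> (h a \<otimes>\<^bsub>S\<^esub> s) = h a \<otimes>\<^bsub>S\<^esub> (h b \<otimes>\<^bsub>S\<^esub> s)"
        using M'car[OF as(2)] as(1) b(1) by (simp add: S.m_ac)
      then show "\<theta>' (h a \<otimes>\<^bsub>S\<^esub> s) = a \<otimes> \<theta>' s"
        using MD(6)[OF as(1) bM[OF as(2)]] by (simp add: \<theta>'_def)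
    qed (simp_all add: M'car addM' multM' \<theta>'_def MD(2) bM)
    \<comment> \<open>Here \<open>\<theta>' d\<close> equals \<open>b \<otimes> \<theta> d\<close>,
      a product of nonzero elements of the domain \<open>R\<close>.\<close>
    moreover have "\<theta>' d \<noteq> \<zero>"
      using MD(6)[OF b(1) d(1)] dR.integral[OF _ b(1) MD(2)[OF d(1)]] b(2) d(2)
      unfolding \<theta>'_def by argo
    ultimately show ?thesis using sub xM' d(1) by (intro exI[of _ M'] exI[of _ \<theta>']) auto
  next
    case False
    \<comment> \<open>Subtracting the two representations puts the multiple of \<open>x\<close> by
      \<open>a \<ominus> b\<close> into \<open>M\<close>, and the case assumption forces
      \<open>a = b\<close>. This justifies the \<open>THE\<close> in
      \<open>\<theta>'\<close>.\<close>
    have uniq: "m = n" if mn: "m \<in> M" "n \<in> M" "a \<in> carrier R" "b \<in> carrier R"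
      and eq: "m \<oplus>\<^bsub>S\<^esub> h a \<otimes>\<^bsub>S\<^esub> x = n \<oplus>\<^bsub>S\<^esub> h b \<otimes>\<^bsub>S\<^esub> x" for m n a b
    proof -
      have carr: "m \<in> carrier S" "n \<in> carrier S" using mn(1,2) MD(1) by simp_all
      have "h (a \<ominus> b) \<otimes>\<^bsub>S\<^esub> x = (m \<oplus>\<^bsub>S\<^esub> h a \<otimes>\<^bsub>S\<^esub> x) \<ominus>\<^bsub>S\<^esub> (m \<oplus>\<^bsub>S\<^esub> h b \<otimes>\<^bsub>S\<^esub> x)"
        using carr(1) mn(3,4) x hom_closed[OF mn(3)] hom_closed[OF mn(4)]
        by (simp add: R.minus_eq S.minus_eq S.l_distr S.l_minus S.minus_add S.a_ac S.r_neg1 S.r_neg2)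
      also have "\<dots> = (n \<oplus>\<^bsub>S\<^esub> h b \<otimes>\<^bsub>S\<^esub> x) \<ominus>\<^bsub>S\<^esub> (m \<oplus>\<^bsub>S\<^esub> h b \<otimes>\<^bsub>S\<^esub> x)"
        by (simp only: eq)
      also have "\<dots> = n \<oplus>\<^bsub>S\<^esub> h (\<ominus> \<one>) \<otimes>\<^bsub>S\<^esub> m"
        using carr mn(4) x by (simp add: S.minus_eq S.l_minus S.minus_add S.a_ac S.r_neg S.r_neg1 S.r_neg2)
      also have "\<dots> \<in> M" by (intro MD(3,5) mn) simp
      finally have "a \<ominus> b = \<zero>" using False mn(3,4) by blast
      then have "a = b" using mn(3,4) by simp
      then show ?thesis using eq carr mn(4) x by simp
    qed
    define \<theta>' where "\<theta>' s = \<theta> (THE m. m \<in> M \<and> (\<exists>a\<in>carrier R. s = m \<oplus>\<^bsub>S\<^esub> h a \<otimes>\<^bsub>S\<^esub> x))" for s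
    have \<theta>': "\<theta>' (m \<oplus>\<^bsub>S\<^esub> h a \<otimes>\<^bsub>S\<^esub> x) = \<theta> m" if "m \<in> M" "a \<in> carrier R" for m a
    proof -
      have "(THE n. n \<in> M \<and> (\<exists>b\<in>carrier R. m \<oplus>\<^bsub>S\<^esub> h a \<otimes>\<^bsub>S\<^esub> x = n \<oplus>\<^bsub>S\<^esub> h b \<otimes>\<^bsub>S\<^esub> x)) = m"
      proof (rule the_equality)
        show "m \<in> M \<and> (\<exists>b\<in>carrier R. m \<oplus>\<^bsub>S\<^esub> h a \<otimes>\<^bsub>S\<^esub> x = m \<oplus>\<^bsub>S\<^esub> h b \<otimes>\<^bsub>S\<^esub> x)" using that by blast
        show "n = m" if "n \<in> M \<and> (\<exists>b\<in>carrier R. m \<oplus>\<^bsub>S\<^esub> h a \<otimes>\<^bsub>S\<^esub> x = n \<oplus>\<^bsub>S\<^esub> h b \<otimes>\<^bsub>S\<^esub> x)" for n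
          using that uniq[OF \<open>m \<in> M\<close> _ \<open>a \<in> carrier R\<close>] by blast
      qed
      then show ?thesis by (simp add: \<theta>'_def)
    qed
    have "functional_on M' \<theta>'"
      unfolding functional_on_def
    proof (intro conjI ballI subsetI)
      fix s assume "s \<in> M'"
      then obtain m a where s: "m \<in> M" "a \<in> carrier R" "s = m \<oplus>\<^bsub>S\<^esub> h a \<otimes>\<^bsub>S\<^esub> x" using M'E by blast
      then show "\<theta>' s \<in> carrier R" using \<theta>'[OF s(1,2)] MD(2)[OF s(1)] by simp
    next
      fix s t assume st: "s \<in> M'" "t \<in> M'"
      obtain m a where s: "m \<in> M" "a \<in> carrier R" "s = m \<oplus>\<^bsub>S\<^esub> h a \<otimes>\<^bsub>S\<^esub> x" using M'E[OF st(1)] by blast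
      obtain n b where t: "n \<in> M" "b \<in> carrier R" "t = n \<oplus>\<^bsub>S\<^esub> h b \<otimes>\<^bsub>S\<^esub> x" using M'E[OF st(2)] by blast
      show "\<theta>' (s \<oplus>\<^bsub>S\<^esub> t) = \<theta>' s \<oplus> \<theta>' t"
        unfolding s(3) t(3) add[OF s(1) t(1) s(2) t(2)]
        using \<theta>'[OF s(1,2)] \<theta>'[OF t(1,2)] \<theta>'[OF MD(3)[OF s(1) t(1)] R.a_closed[OF s(2) t(2)]]
          MD(4)[OF s(1) t(1)] by argo
    next
      fix b s assume bs: "b \<in> carrier R" "s \<in> M'"
      obtain m a where s: "m \<in> M" "a \<in> carrier R" "s = m \<oplus>\<^bsub>S\<^esub> h a \<otimes>\<^bsub>S\<^esub> x" using M'E[OF bs(2)] by blast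
      show "\<theta>' (h b \<otimes>\<^bsub>S\<^esub> s) = b \<otimes> \<theta>' s"
        unfolding s(3) mult[OF s(1,2) bs(1)]
        using \<theta>'[OF s(1,2)] \<theta>'[OF MD(5)[OF bs(1) s(1)] R.m_closed[OF bs(1) s(2)]]
          MD(6)[OF bs(1) s(1)] by argo
    qed (simp_all add: M'car addM' multM')
    moreover have "\<theta>' d = \<theta> d" using \<theta>'[OF d(1) R.zero_closed] x MD(1)[OF d(1)] by simp
    ultimately show ?thesis using sub xM' d by (intro exI[of _ M'] exI[of _ \<theta>']) auto
  qed
qed

lemma functional_on_finite:
  assumes d: "d \<in> carrier S" "d \<noteq> \<zero>\<^bsub>S\<^esub>" and "finite E" "E \<subseteq> carrier S"
  shows "\<exists>M \<theta>. functional_on M \<theta> \<and> d \<in> M \<and> \<theta> d \<noteq> \<zero> \<and> E \<subseteq> M"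
  using assms(3,4)
proof (induction E rule: finite_induct)
  case empty
  then show ?case using functional_on_line[OF d] by simp
next
  case (insert x E)
  have E: "E \<subseteq> carrier S" and x: "x \<in> carrier S" using insert.prems by simp_all
  obtain M \<theta> where M: "functional_on M \<theta>" "d \<in> M" "\<theta> d \<noteq> \<zero>" "E \<subseteq> M"
    using insert.IH[OF E] by (elim exE conjE) (rule that)
  obtain M' \<theta>' where M': "functional_on M' \<theta>'" "d \<in> M'" "\<theta>' d \<noteq> \<zero>" "M \<subseteq> M'" "x \<in> M'"
    using functional_on_extend[OF M(1-3) x] by (elim exE conjE) (rule that)
  then show ?case using M(4) by (intro exI[of _ M'] exI[of _ \<theta>']) auto
qed

text \<open>Extending over finitely many module generators gives a domain \<open>M\<close> that
  contains them and is closed under \<open>R\<close>-linear combinations, hence is all of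
  \<open>S\<close>.\<close>

lemma nonvanishing_functional:
  assumes ext: "module_finite_ext R S h" and d: "d \<in> carrier S" "d \<noteq> \<zero>\<^bsub>S\<^esub>"
  shows "\<exists>\<theta>. functional_on (carrier S) \<theta> \<and> \<theta> d \<noteq> \<zero>"
proof -
  obtain E where E: "finite E" "E \<subseteq> carrier S"
    "\<forall>s\<in>carrier S. \<exists>g\<in>E \<rightarrow> carrier R. s = (\<Oplus>\<^bsub>S\<^esub>x\<in>E. h (g x) \<otimes>\<^bsub>S\<^esub> x)"
    using ext unfolding module_finite_ext_def by blast
  obtain M \<theta> where M: "functional_on M \<theta>" "d \<in> M" "\<theta> d \<noteq> \<zero>" "E \<subseteq> M"
    using functional_on_finite[OF d E(1,2)] by (elim exE conjE) (rule that)
  note MD = functional_onD[OF M(1)]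
  have zero: "\<zero>\<^bsub>S\<^esub> \<in> M" using MD(5)[OF R.zero_closed M(2)] MD(1)[OF M(2)] by simp
  have span: "(\<Oplus>\<^bsub>S\<^esub>x\<in>F. h (g x) \<otimes>\<^bsub>S\<^esub> x) \<in> M" if g: "g \<in> E \<rightarrow> carrier R" and F: "F \<subseteq> E" for g F
    using finite_subset[OF F E(1)] F
  proof (induction F rule: finite_induct)
    case (insert x F)
    have x: "x \<in> M" "g x \<in> carrier R" using insert.prems M(4) g by auto
    have "(\<lambda>x. h (g x) \<otimes>\<^bsub>S\<^esub> x) \<in> F \<rightarrow> carrier S"
      using insert.prems E(2) g by (intro Pi_I S.m_closed hom_closed) (auto dest: funcset_mem)
    then have "(\<Oplus>\<^bsub>S\<^esub>x\<in>insert x F. h (g x) \<otimes>\<^bsub>S\<^esub> x) = h (g x) \<otimes>\<^bsub>S\<^esub> x \<oplus>\<^bsub>S\<^esub> (\<Oplus>\<^bsub>S\<^esub>x\<in>F. h (g x) \<otimes>\<^bsub>S\<^esub> x)"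
      using insert.hyps x MD(1)[OF x(1)] by (intro S.finsum_insert) simp_all
    also have "\<dots> \<in> M" using insert by (intro MD(3,5) x) simp
    finally show ?case .
  qed (simp add: zero)
  have "M = carrier S"
  proof (intro equalityI subsetI)
    fix s assume "s \<in> carrier S"
    then obtain g where "g \<in> E \<rightarrow> carrier R" "s = (\<Oplus>\<^bsub>S\<^esub>x\<in>E. h (g x) \<otimes>\<^bsub>S\<^esub> x)" using E(3) by blast
    then show "s \<in> M" using span[OF _ order.refl] by simp
  qed (rule MD(1))
  then show ?thesis using M(1,3) by (intro exI[of _ \<theta>]) simp
qed

text \<open>By linearity, \<open>\<theta>\<close> sends \<open>t\<close> times \<open>h k\<close> to
  \<open>k\<close> times \<open>\<theta> t\<close>, which lies in \<open>K\<close>.\<close>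

lemma functional_on_Idl:
  assumes \<theta>: "functional_on (carrier S) \<theta>" and K: "ideal K R" and s: "s \<in> Idl\<^bsub>S\<^esub> (h ` K)"
  shows "\<theta> s \<in> K"
proof -
  interpret K: ideal K R by fact
  note \<theta>D = functional_onD[OF \<theta>]
  have "\<theta> (h \<zero> \<otimes>\<^bsub>S\<^esub> \<zero>\<^bsub>S\<^esub>) = \<zero>" using \<theta>D(2)[of "\<zero>\<^bsub>S\<^esub>"] \<theta>D(6)[of \<zero> "\<zero>\<^bsub>S\<^esub>"] by simp
  then have \<theta>0: "\<theta> \<zero>\<^bsub>S\<^esub> = \<zero>" by simp
  \<comment> \<open>The preimage of \<open>K\<close> under \<open>\<theta>\<close> need not absorb
    multiplication by \<open>S\<close>; quantifying over \<open>t\<close> builds this in, and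
    \<open>t\<close> equal to one gives the claim at the end.\<close>
  have "ideal {s \<in> carrier S. \<forall>t\<in>carrier S. \<theta> (t \<otimes>\<^bsub>S\<^esub> s) \<in> K} S"
  proof (rule S.idealI_comm)
    show "\<zero>\<^bsub>S\<^esub> \<in> {s \<in> carrier S. \<forall>t\<in>carrier S. \<theta> (t \<otimes>\<^bsub>S\<^esub> s) \<in> K}"
      using \<theta>0 K.zero_closed by simp
  next
    fix a b assume "a \<in> {s \<in> carrier S. \<forall>t\<in>carrier S. \<theta> (t \<otimes>\<^bsub>S\<^esub> s) \<in> K}"
      "b \<in> {s \<in> carrier S. \<forall>t\<in>carrier S. \<theta> (t \<otimes>\<^bsub>S\<^esub> s) \<in> K}"
    then show "a \<oplus>\<^bsub>S\<^esub> b \<in> {s \<in> carrier S. \<forall>t\<in>carrier S. \<theta> (t \<otimes>\<^bsub>S\<^esub> s) \<in> K}"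
      by (simp add: S.r_distr \<theta>D(4) K.a_closed)
  next
    fix a x assume a: "a \<in> {s \<in> carrier S. \<forall>t\<in>carrier S. \<theta> (t \<otimes>\<^bsub>S\<^esub> s) \<in> K}" and x: "x \<in> carrier S"
    then have "\<theta> (t \<otimes>\<^bsub>S\<^esub> (x \<otimes>\<^bsub>S\<^esub> a)) \<in> K" if "t \<in> carrier S" for t
      using that by (simp add: S.m_assoc[symmetric])
    then show "x \<otimes>\<^bsub>S\<^esub> a \<in> {s \<in> carrier S. \<forall>t\<in>carrier S. \<theta> (t \<otimes>\<^bsub>S\<^esub> s) \<in> K}"
      using a x by simp
  qed simp
  moreover have "h ` K \<subseteq> {s \<in> carrier S. \<forall>t\<in>carrier S. \<theta> (t \<otimes>\<^bsub>S\<^esub> s) \<in> K}"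
  proof
    fix s assume "s \<in> h ` K"
    then obtain k where k: "k \<in> K" "s = h k" by blast
    have "\<theta> (t \<otimes>\<^bsub>S\<^esub> s) \<in> K" if t: "t \<in> carrier S" for t
    proof -
      have "t \<otimes>\<^bsub>S\<^esub> s = h k \<otimes>\<^bsub>S\<^esub> t" using k t by (simp add: S.m_comm)
      then show ?thesis using \<theta>D(6)[of k t] \<theta>D(2)[OF t] k(1) t by (simp add: K.I_r_closed)
    qed
    then show "s \<in> {s \<in> carrier S. \<forall>t\<in>carrier S. \<theta> (t \<otimes>\<^bsub>S\<^esub> s) \<in> K}" using k by simp
  qed
  ultimately have "Idl\<^bsub>S\<^esub> (h ` K) \<subseteq> {s \<in> carrier S. \<forall>t\<in>carrier S. \<theta> (t \<otimes>\<^bsub>S\<^esub> s) \<in> K}"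
    by (rule S.genideal_minimal)
  then have "s \<in> carrier S" "\<theta> (\<one>\<^bsub>S\<^esub> \<otimes>\<^bsub>S\<^esub> s) \<in> K" using s by blast+
  then show ?thesis by simp
qed

end

section \<open>Tight closure under homomorphisms and localization\<close>

context ring_hom_cring
begin

lemma hom_frob_power:
  assumes I: "I \<subseteq> carrier R" and x: "x \<in> frob_power R I q"
  shows "h x \<in> frob_power S (Idl\<^bsub>S\<^esub> (h ` I)) q"
proof -
  have hI: "h ` I \<subseteq> carrier S" using I by auto
  interpret J: ideal "Idl\<^bsub>S\<^esub> (h ` I)" S by (rule S.genideal_ideal[OF hI])
  have "h x \<in> Idl\<^bsub>S\<^esub> (h ` ((\<lambda>x. x [^]\<^bsub>R\<^esub> q) ` I))"
    by (rule hom_Idl) (use I x in \<open>auto simp: frob_power_def\<close>)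
  also have "\<dots> \<subseteq> frob_power S (Idl\<^bsub>S\<^esub> (h ` I)) q"
  proof (rule S.genideal_minimal[OF S.frob_power_ideal[OF J.a_subset]], clarify)
    fix a assume a: "a \<in> I"
    then have "h a \<in> Idl\<^bsub>S\<^esub> (h ` I)" using S.genideal_self[OF hI] by auto
    then show "h (a [^]\<^bsub>R\<^esub> q) \<in> frob_power S (Idl\<^bsub>S\<^esub> (h ` I)) q"
      using a I S.pow_mem_frob_power[OF J.a_subset] by (simp add: hom_pow subset_iff)
  qed
  finally show ?thesis .
qed

text \<open>Elements of the extended ideal are combinations of generators, and characteristic
  \<open>p\<close> reduces their \<open>p ^ e\<close>-th powers to those of the generators.\<close>

lemma frob_power_Idl_image:
  assumes p: "has_char R p" and I: "I \<subseteq> carrier R"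
  shows "frob_power S (Idl\<^bsub>S\<^esub> (h ` I)) (p ^ e) \<subseteq> Idl\<^bsub>S\<^esub> (h ` frob_power R I (p ^ e))"
proof -
  interpret F: ideal "frob_power R I (p ^ e)" R by (rule R.frob_power_ideal[OF I])
  have hF: "h ` frob_power R I (p ^ e) \<subseteq> carrier S" by auto
  interpret K: ideal "Idl\<^bsub>S\<^esub> (h ` frob_power R I (p ^ e))" S by (rule S.genideal_ideal[OF hF])
  have id: "ideal {y \<in> carrier S. \<one>\<^bsub>S\<^esub> \<otimes>\<^bsub>S\<^esub> y [^]\<^bsub>S\<^esub> (p ^ e) \<in> Idl\<^bsub>S\<^esub> (h ` frob_power R I (p ^ e))} S"
    by (rule S.frobenius_preimage_ideal[OF has_char_hom[OF p] K.is_ideal S.one_closed])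
  have "Idl\<^bsub>S\<^esub> (h ` I) \<subseteq> {y \<in> carrier S. \<one>\<^bsub>S\<^esub> \<otimes>\<^bsub>S\<^esub> y [^]\<^bsub>S\<^esub> (p ^ e) \<in> Idl\<^bsub>S\<^esub> (h ` frob_power R I (p ^ e))}"
  proof (rule S.genideal_minimal[OF id], rule image_subsetI)
    fix a assume a: "a \<in> I"
    then have ac: "a \<in> carrier R" using I by blast
    have "h (a [^]\<^bsub>R\<^esub> (p ^ e)) \<in> Idl\<^bsub>S\<^esub> (h ` frob_power R I (p ^ e))"
      by (rule subsetD[OF S.genideal_self[OF hF]]) (rule imageI[OF R.pow_mem_frob_power[OF I a]])
    then show "h a \<in> {y \<in> carrier S. \<one>\<^bsub>S\<^esub> \<otimes>\<^bsub>S\<^esub> y [^]\<^bsub>S\<^esub> (p ^ e) \<in> Idl\<^bsub>S\<^esub> (h ` frob_power R I (p ^ e))}"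
      using ac by (simp add: hom_pow)
  qed
  then show ?thesis
    unfolding frob_power_def[of S] by (intro S.genideal_minimal[OF K.is_ideal]) auto
qed

end

lemma (in domain) minimal_prime_iff: "minimal_prime P R \<longleftrightarrow> P = {\<zero>}"
proof
  assume P: "P = {\<zero>}"
  have "Q = {\<zero>}" if Q: "primeideal Q R" "Q \<subseteq> {\<zero>}" for Q
    using additive_subgroup.zero_closed[OF ideal.axioms(1)[OF primeideal.axioms(1)[OF Q(1)]]] Q(2) by blast
  then show "minimal_prime P R" using zeroprimeideal P unfolding minimal_prime_def by blast
qed (rule minimal_prime_domain[OF domain_axioms])

text \<open>The functional is chosen for \<open>d\<close> before the exponent varies, so
  \<open>\<theta> d\<close> is one multiplier for all large \<open>e\<close>; being nonzero, it
  avoids the only minimal prime of \<open>R\<close>.\<close>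

lemma (in domain_extension) tight_closure_contraction:
  assumes p: "has_char R p" and ext: "module_finite_ext R S h" and I: "I \<subseteq> carrier R"
    and y: "y \<in> carrier R" and hy: "h y \<in> tight_closure p S (Idl\<^bsub>S\<^esub> (h ` I))"
  shows "y \<in> tight_closure p R I"
proof -
  obtain d e0 where d: "d \<in> carrier S" "\<forall>P. minimal_prime P S \<longrightarrow> d \<notin> P"
    "\<forall>e\<ge>e0. d \<otimes>\<^bsub>S\<^esub> h y [^]\<^bsub>S\<^esub> (p ^ e) \<in> frob_power S (Idl\<^bsub>S\<^esub> (h ` I)) (p ^ e)"
    using hy unfolding tight_closure_def mem_Collect_eq by (elim conjE bexE exE) (rule that)
  have d0: "d \<noteq> \<zero>\<^bsub>S\<^esub>" using d(2) by (simp add: dS.minimal_prime_iff)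
  obtain \<theta> where \<theta>: "functional_on (carrier S) \<theta>" "\<theta> d \<noteq> \<zero>"
    using nonvanishing_functional[OF ext d(1) d0] by (elim exE conjE) (rule that)
  have \<theta>d: "\<theta> d \<in> carrier R" by (rule functional_onD(2)[OF \<theta>(1) d(1)])
  have "\<theta> d \<otimes> y [^] (p ^ e) \<in> frob_power R I (p ^ e)" if "e0 \<le> e" for e
  proof -
    have "h (y [^] (p ^ e)) \<otimes>\<^bsub>S\<^esub> d = d \<otimes>\<^bsub>S\<^esub> h y [^]\<^bsub>S\<^esub> (p ^ e)"
      using y d(1) by (simp add: hom_pow S.m_comm)
    then have "h (y [^] (p ^ e)) \<otimes>\<^bsub>S\<^esub> d \<in> Idl\<^bsub>S\<^esub> (h ` frob_power R I (p ^ e))"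
      using d(3) that subsetD[OF frob_power_Idl_image[OF p I]] by simp
    then have "\<theta> (h (y [^] (p ^ e)) \<otimes>\<^bsub>S\<^esub> d) \<in> frob_power R I (p ^ e)"
      by (rule functional_on_Idl[OF \<theta>(1) R.frob_power_ideal[OF I]])
    then show ?thesis
      using functional_onD(6)[OF \<theta>(1) R.nat_pow_closed[OF y] d(1)] \<theta>d y by (simp add: R.m_comm)
  qed
  then show ?thesis
    using y \<theta>d \<theta>(2) unfolding tight_closure_def by (auto simp: dR.minimal_prime_iff)
qed

context localizing
begin

lemma has_char_localization: "has_char R p \<Longrightarrow> has_char L p"
  by (rule loc.has_char_hom)

text \<open>The image of \<open>c\<close> is the multiplier, since minimal primes of
  \<open>L\<close> contract to minimal primes of \<open>R\<close>. The factor \<open>w\<close> may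
  vary with \<open>e\<close>, as it becomes a unit in \<open>L\<close>.\<close>

lemma tight_closure_localizationI:
  assumes I: "ideal I R" and z: "z \<in> carrier R" and c: "c \<in> carrier R"
    and minimal: "\<forall>P. minimal_prime P R \<longrightarrow> c \<notin> P"
    and mem: "\<forall>e\<ge>e0. \<exists>w\<in>U. w \<otimes> (c \<otimes> z [^] (p ^ e)) \<in> frob_power R I (p ^ e)"
  shows "loc_map R U z \<in> tight_closure p L (ext_ideal R U I)"
proof -
  interpret I: ideal I R by fact
  have "loc_map R U c \<notin> Q" if "minimal_prime Q L" for Q
    using minimal contraction_minimal_prime[OF that] c by blast
  moreover have "loc_map R U c \<otimes>\<^bsub>L\<^esub> loc_map R U z [^]\<^bsub>L\<^esub> (p ^ e) \<in> frob_power L (ext_ideal R U I) (p ^ e)"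
    if "e0 \<le> e" for e
  proof -
    have "loc_map R U c \<otimes>\<^bsub>L\<^esub> loc_map R U z [^]\<^bsub>L\<^esub> (p ^ e) = frac R U (c \<otimes> z [^] (p ^ e)) \<one>"
      using c z by (simp only: loc.hom_pow loc.hom_mult nat_pow_closed loc_map_def[symmetric])
    also have "\<dots> \<in> ext_ideal R U (frob_power R I (p ^ e))"
      using mem that c z
      by (subst frac_mem_ext_ideal_iff[OF frob_power_ideal[OF I.a_subset] _ U_one]) simp_all
    finally show ?thesis by (simp only: frob_power_ext_ideal[OF I])
  qed
  ultimately show ?thesis
    using loc.hom_closed[OF c] loc.hom_closed[OF z] unfolding tight_closure_def by blast
qed

text \<open>The numerator \<open>c\<close> of the multiplier is controlled only at minimal primes
  that survive in \<open>L\<close>, and \<open>w\<close> depends on \<open>e\<close>. Removing this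
  dependence is what the extension domains are for.\<close>

lemma tight_closure_localizationD:
  assumes I: "ideal I R" and z: "z \<in> carrier R"
    and mem: "loc_map R U z \<in> tight_closure p L (ext_ideal R U I)"
  shows "\<exists>c\<in>carrier R. (\<forall>P. minimal_prime P R \<and> P \<inter> U = {} \<longrightarrow> c \<notin> P) \<and>
    (\<exists>e0. \<forall>e\<ge>e0. \<exists>w\<in>U. w \<otimes> (c \<otimes> z [^] (p ^ e)) \<in> frob_power R I (p ^ e))"
proof -
  interpret I: ideal I R by fact
  obtain x e0 where x: "x \<in> carrier L" "\<forall>Q. minimal_prime Q L \<longrightarrow> x \<notin> Q"
    "\<forall>e\<ge>e0. x \<otimes>\<^bsub>L\<^esub> loc_map R U z [^]\<^bsub>L\<^esub> (p ^ e) \<in> frob_power L (ext_ideal R U I) (p ^ e)"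
    using mem unfolding tight_closure_def mem_Collect_eq by (elim conjE bexE exE) (rule that)
  obtain c v where c: "c \<in> carrier R" "v \<in> U" "x = frac R U c v" by (rule localization_cases[OF x(1)])
  have notin: "c \<notin> P" if P: "minimal_prime P R \<and> P \<inter> U = {}" for P
  proof
    assume "c \<in> P"
    moreover have "ideal P R" using P primeideal.axioms(1) by (auto simp: minimal_prime_def)
    ultimately have "x \<in> ext_ideal R U P" using c(2) unfolding c(3) ext_ideal_eq[OF \<open>ideal P R\<close>] by blast
    then show False using x(2) ext_ideal_minimal_prime P by blast
  qed
  have mem': "\<exists>w\<in>U. w \<otimes> (c \<otimes> z [^] (p ^ e)) \<in> frob_power R I (p ^ e)" if "e0 \<le> e" for e
  proof -
    have "x \<otimes>\<^bsub>L\<^esub> loc_map R U z [^]\<^bsub>L\<^esub> (p ^ e) = frac R U (c \<otimes> z [^] (p ^ e)) v"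
      using c z U_one by (simp add: loc_map_def frac_pow frac_mult U_carrier)
    moreover have "x \<otimes>\<^bsub>L\<^esub> loc_map R U z [^]\<^bsub>L\<^esub> (p ^ e) \<in> frob_power L (ext_ideal R U I) (p ^ e)"
      using x(3) that by blast
    ultimately have "frac R U (c \<otimes> z [^] (p ^ e)) v \<in> ext_ideal R U (frob_power R I (p ^ e))"
      by (simp only: frob_power_ext_ideal[OF I])
    then show ?thesis
      using c(1,2) z by (subst (asm) frac_mem_ext_ideal_iff[OF frob_power_ideal[OF I.a_subset]]) simp_all
  qed
  show ?thesis
    by (intro bexI[OF _ c(1)] conjI allI impI exI[of _ e0]) (simp_all add: notin mem')
qed

text \<open>The easy inclusion: a multiplier for \<open>R\<close> also works in \<open>L\<close>,
  with \<open>w = \<one>\<close>.\<close>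

lemma ext_ideal_tight_closure_subset:
  assumes p: "has_char R p" and I: "ideal I R"
  shows "ext_ideal R U (tight_closure p R I) \<subseteq> tight_closure p L (ext_ideal R U I)"
proof -
  interpret E: ideal "ext_ideal R U I" L by (rule ext_ideal_ideal[OF I])
  have "loc_map R U z \<in> tight_closure p L (ext_ideal R U I)" if z: "z \<in> tight_closure p R I" for z
  proof -
    obtain c e0 where c: "z \<in> carrier R" "c \<in> carrier R" "\<forall>P. minimal_prime P R \<longrightarrow> c \<notin> P"
      "\<forall>e\<ge>e0. c \<otimes> z [^] (p ^ e) \<in> frob_power R I (p ^ e)"
      using z unfolding tight_closure_def mem_Collect_eq by (elim conjE bexE exE) (rule that)
    have "\<forall>e\<ge>e0. \<exists>w\<in>U. w \<otimes> (c \<otimes> z [^] (p ^ e)) \<in> frob_power R I (p ^ e)"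
      using c by (intro allI impI bexI[OF _ U_one]) simp
    then show ?thesis by (rule tight_closure_localizationI[OF I c(1,2,3)])
  qed
  then show ?thesis
    unfolding ext_ideal_def[of _ _ "tight_closure p R I"]
    by (intro L.genideal_minimal L.tight_closure_ideal has_char_localization[OF p] E.a_subset) auto
qed

end

section \<open>Quotients by minimal primes and the converse inclusion\<close>

lemma (in ring) rcos_surj: "x \<in> carrier (R Quot I) \<Longrightarrow> \<exists>a\<in>carrier R. x = I +> a"
  by (auto simp: FactRing_simps)

text \<open>By surjectivity of the quotient map, the image of an ideal is already an ideal.\<close>

lemma (in ideal) Idl_rcos_image:
  assumes "cring R" and K: "ideal K R"
  shows "Idl\<^bsub>R Quot I\<^esub> ((+>) I ` K) \<subseteq> (+>) I ` K"
proof -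
  interpret Q: ring_hom_cring R "R Quot I" "(+>) I" by (rule rcos_ring_hom_cring[OF assms(1)])
  interpret K: ideal K R by fact
  have "ideal ((+>) I ` K) (R Quot I)"
  proof (rule Q.S.idealI_comm)
    show "(+>) I ` K \<subseteq> carrier (R Quot I)" by auto
    show "\<zero>\<^bsub>R Quot I\<^esub> \<in> (+>) I ` K" using K.zero_closed Q.hom_zero by (metis imageI)
  next
    fix a b assume "a \<in> (+>) I ` K" "b \<in> (+>) I ` K"
    then obtain k l where kl: "k \<in> K" "l \<in> K" "a = I +> k" "b = I +> l" by blast
    then have "a \<oplus>\<^bsub>R Quot I\<^esub> b = I +> (k \<oplus> l)" by simp
    then show "a \<oplus>\<^bsub>R Quot I\<^esub> b \<in> (+>) I ` K" using kl K.a_closed by blast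
  next
    fix a x assume a: "a \<in> (+>) I ` K" and x: "x \<in> carrier (R Quot I)"
    obtain k where k: "k \<in> K" "a = I +> k" using a by blast
    obtain r where r: "r \<in> carrier R" "x = I +> r" using rcos_surj[OF x] by blast
    then have "x \<otimes>\<^bsub>R Quot I\<^esub> a = I +> (r \<otimes> k)" using k r by simp
    then show "x \<otimes>\<^bsub>R Quot I\<^esub> a \<in> (+>) I ` K" using K.I_l_closed[OF k(1) r(1)] by (rule image_eqI)
  qed
  then show ?thesis by (rule Q.S.genideal_minimal) simp
qed

text \<open>Replaces the \<open>e\<close>-dependent factors \<open>w\<close> by a single
  \<open>u\<close>, passing through the quotient by \<open>P\<close> to \<open>S\<close>, where
  commutation with localization is available, and back.\<close>

lemma (in localizing) tight_closure_modulo_prime: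
  fixes S :: "('c, 'd) ring_scheme"
  assumes p: "has_char R p" and I: "ideal I R" and z: "z \<in> carrier R"
    and mem: "loc_map R U z \<in> tight_closure p L (ext_ideal R U I)"
    and P: "minimal_prime P R" and disj: "P \<inter> U = {}"
    and S: "domain S" and ext: "module_finite_ext (R Quot P) S f"
    and tc: "tc_commutes_with_localization p S"
  shows "\<exists>u\<in>U. tight_modulo p I P (u \<otimes> z)"
proof -
  define \<pi> where "\<pi> = (+>) P"
  interpret I: ideal I R by fact
  interpret P: primeideal P R using P by (simp add: minimal_prime_def)
  interpret Q: ring_hom_cring R "R Quot P" \<pi> unfolding \<pi>_def by (rule P.rcos_ring_hom_cring)
  interpret dQ: domain "R Quot P" by (rule P.quotient_is_domain)
  interpret dS: domain S by (rule S)
  interpret f: domain_extension "R Quot P" S f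
    using ext by unfold_locales (auto simp: module_finite_ext_def)
  have \<pi>_eq: "a \<ominus> b \<in> P \<longleftrightarrow> \<pi> a = \<pi> b" if "a \<in> carrier R" "b \<in> carrier R" for a b
    unfolding \<pi>_def by (rule quotient_eq_iff_same_a_r_cos[OF P.is_ideal that])
  have \<pi>_zero: "\<pi> a = \<zero>\<^bsub>R Quot P\<^esub> \<longleftrightarrow> a \<in> P" if "a \<in> carrier R" for a
    using \<pi>_eq[OF that zero_closed] that by (simp add: minus_eq)
  have \<pi>_surj: "\<exists>a\<in>carrier R. x = \<pi> a" if "x \<in> carrier (R Quot P)" for x
    using rcos_surj[OF that] unfolding \<pi>_def .
  define J where "J = Idl\<^bsub>R Quot P\<^esub> (\<pi> ` I)"
  define K where "K = Idl\<^bsub>S\<^esub> (f ` J)"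
  have \<pi>I: "\<pi> ` I \<subseteq> carrier (R Quot P)" by auto
  interpret J: ideal J "R Quot P" unfolding J_def by (rule Q.S.genideal_ideal[OF \<pi>I])
  have fJ: "f ` J \<subseteq> carrier S" by auto
  interpret K: ideal K S unfolding K_def by (rule dS.genideal_ideal[OF fJ])
  \<comment> \<open>As \<open>V\<close> is the image of \<open>U\<close>, every factor from
    \<open>V\<close> found in \<open>S\<close> lifts to an element of \<open>U\<close>.\<close>
  define V where "V = (\<lambda>u. f (\<pi> u)) ` U"
  interpret V: localizing S V
  proof
    show "mult_system V S"
      unfolding mult_system_def
    proof (intro conjI ballI)
      show "V \<subseteq> carrier S" by (auto simp: V_def U_carrier)
      show "\<one>\<^bsub>S\<^esub> \<in> V" unfolding V_def by (rule image_eqI[OF _ U_one]) simp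
      fix a b assume "a \<in> V" "b \<in> V"
      then obtain u v where uv: "u \<in> U" "v \<in> U" "a = f (\<pi> u)" "b = f (\<pi> v)" by (auto simp: V_def)
      then have "a \<otimes>\<^bsub>S\<^esub> b = f (\<pi> (u \<otimes> v))" by (simp add: U_carrier)
      then show "a \<otimes>\<^bsub>S\<^esub> b \<in> V" using U_mult[OF uv(1,2)] by (auto simp: V_def)
    qed
  qed
  obtain c e0 where c: "c \<in> carrier R" "\<forall>P. minimal_prime P R \<and> P \<inter> U = {} \<longrightarrow> c \<notin> P"
    "\<forall>e\<ge>e0. \<exists>w\<in>U. w \<otimes> (c \<otimes> z [^] (p ^ e)) \<in> frob_power R I (p ^ e)"
    using tight_closure_localizationD[OF I z mem] by (elim conjE bexE exE) (rule that)
  have "c \<notin> P" using c(2) P disj by blast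
  then have "\<pi> c \<noteq> \<zero>\<^bsub>R Quot P\<^esub>" using \<pi>_zero[OF c(1)] by simp
  \<comment> \<open>In a domain a multiplier need only be nonzero, which here uses injectivity of
    \<open>f\<close>.\<close>
  then have fc: "f (\<pi> c) \<noteq> \<zero>\<^bsub>S\<^esub>" using f.h_eq_zero[OF Q.hom_closed[OF c(1)]] by blast
  have "loc_map S V (f (\<pi> z)) \<in> tight_closure p (localization S V) (ext_ideal S V K)"
  proof (rule V.tight_closure_localizationI[OF K.is_ideal])
    show "\<forall>e\<ge>e0. \<exists>w\<in>V. w \<otimes>\<^bsub>S\<^esub> (f (\<pi> c) \<otimes>\<^bsub>S\<^esub> f (\<pi> z) [^]\<^bsub>S\<^esub> (p ^ e)) \<in> frob_power S K (p ^ e)"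
    proof (intro allI impI)
      fix e assume "e0 \<le> e"
      then obtain w where w: "w \<in> U" "w \<otimes> (c \<otimes> z [^] (p ^ e)) \<in> frob_power R I (p ^ e)"
        using c(3) by blast
      have "f (\<pi> (w \<otimes> (c \<otimes> z [^] (p ^ e)))) \<in> frob_power S K (p ^ e)"
        unfolding K_def J_def
        by (intro f.hom_frob_power Q.hom_frob_power w(2) I.a_subset J.a_subset[unfolded J_def])
      moreover have "f (\<pi> (w \<otimes> (c \<otimes> z [^] (p ^ e)))) =
          f (\<pi> w) \<otimes>\<^bsub>S\<^esub> (f (\<pi> c) \<otimes>\<^bsub>S\<^esub> f (\<pi> z) [^]\<^bsub>S\<^esub> (p ^ e))"
        using w(1) c(1) z by (simp add: U_carrier Q.hom_pow f.hom_pow)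
      ultimately show "\<exists>w\<in>V. w \<otimes>\<^bsub>S\<^esub> (f (\<pi> c) \<otimes>\<^bsub>S\<^esub> f (\<pi> z) [^]\<^bsub>S\<^esub> (p ^ e)) \<in> frob_power S K (p ^ e)"
        using w(1) by (intro bexI[of _ "f (\<pi> w)"]) (simp_all add: V_def)
    qed
  qed (use c(1) z fc in \<open>simp_all add: dS.minimal_prime_iff\<close>)
  \<comment> \<open>The hypothesis on \<open>S\<close> enters here; the membership criterion for
    extended ideals then provides one factor \<open>v\<close>, independent of
    \<open>e\<close>.\<close>
  also have "\<dots> = ext_ideal S V (tight_closure p S K)"
    using tc K.is_ideal V.mult_system unfolding tc_commutes_with_localization_def by simp
  finally have "frac S V (f (\<pi> z)) \<one>\<^bsub>S\<^esub> \<in> ext_ideal S V (tight_closure p S K)"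
    by (simp only: loc_map_def)
  moreover have "ideal (tight_closure p S K) S"
    by (intro dS.tight_closure_ideal K.a_subset f.has_char_hom Q.has_char_hom p)
  ultimately obtain v where v: "v \<in> V" "v \<otimes>\<^bsub>S\<^esub> f (\<pi> z) \<in> tight_closure p S K"
    using V.frac_mem_ext_ideal_iff[of "tight_closure p S K" "f (\<pi> z)" "\<one>\<^bsub>S\<^esub>"] V.U_one z by auto
  then obtain u where u: "u \<in> U" "v = f (\<pi> u)" by (auto simp: V_def)
  have uz: "u \<otimes> z \<in> carrier R" using u(1) z by (simp add: U_carrier)
  have "f (\<pi> (u \<otimes> z)) \<in> tight_closure p S K" using v(2) u z by (simp add: U_carrier)
  then have "\<pi> (u \<otimes> z) \<in> tight_closure p (R Quot P) J"
    unfolding K_def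
    by (intro f.tight_closure_contraction[OF Q.has_char_hom[OF p] ext J.a_subset Q.hom_closed[OF uz]])
  then obtain x e1 where x: "x \<in> carrier (R Quot P)" "\<forall>M. minimal_prime M (R Quot P) \<longrightarrow> x \<notin> M"
    "\<forall>e\<ge>e1. x \<otimes>\<^bsub>R Quot P\<^esub> \<pi> (u \<otimes> z) [^]\<^bsub>R Quot P\<^esub> (p ^ e) \<in> frob_power (R Quot P) J (p ^ e)"
    unfolding tight_closure_def mem_Collect_eq by (elim conjE bexE exE) (rule that)
  obtain a where a: "a \<in> carrier R" "x = \<pi> a" using \<pi>_surj[OF x(1)] by blast
  have "a \<notin> P" using x(2) \<pi>_zero[OF a(1)] by (simp add: dQ.minimal_prime_iff a(2))
  moreover have "\<exists>k\<in>frob_power R I (p ^ e). a \<otimes> (u \<otimes> z) [^] (p ^ e) \<ominus> k \<in> P" if "e1 \<le> e" for e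
  proof -
    interpret F: ideal "frob_power R I (p ^ e)" R by (rule frob_power_ideal[OF I.a_subset])
    have "\<pi> (a \<otimes> (u \<otimes> z) [^] (p ^ e)) = x \<otimes>\<^bsub>R Quot P\<^esub> \<pi> (u \<otimes> z) [^]\<^bsub>R Quot P\<^esub> (p ^ e)"
      using a uz by (simp only: Q.hom_mult Q.hom_pow nat_pow_closed)
    also have "\<dots> \<in> frob_power (R Quot P) J (p ^ e)" using x(3) that by blast
    \<comment> \<open>Lifting to \<open>R\<close>: the Frobenius power of the extended ideal lies in
      the extension of the Frobenius power, which by surjectivity of \<open>\<pi>\<close> is a plain
      image; \<open>k\<close> is a preimage.\<close>
    also have "\<dots> \<subseteq> Idl\<^bsub>R Quot P\<^esub> (\<pi> ` frob_power R I (p ^ e))"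
      unfolding J_def by (rule Q.frob_power_Idl_image[OF p I.a_subset])
    also have "\<dots> \<subseteq> \<pi> ` frob_power R I (p ^ e)"
      unfolding \<pi>_def by (rule P.Idl_rcos_image[OF is_cring F.is_ideal])
    finally obtain k where k: "k \<in> frob_power R I (p ^ e)" "\<pi> (a \<otimes> (u \<otimes> z) [^] (p ^ e)) = \<pi> k"
      by (rule imageE)
    then show ?thesis using \<pi>_eq[of "a \<otimes> (u \<otimes> z) [^] (p ^ e)" k] a(1) uz
      by (intro bexI[OF _ k(1)]) simp
  qed
  ultimately show ?thesis
    unfolding tight_modulo_def
    by (intro bexI[OF _ u(1)] bexI[OF _ a(1)] conjI exI[of _ e1] allI impI)
qed

text \<open>The assumption \<open>modulo\<close> packages the only input from the extension domains.
  Minimal primes meeting \<open>U\<close> are treated here, and finiteness of the set of minimal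
  primes allows a common factor \<open>u\<close>.\<close>

lemma (in localizing) tight_closure_ext_ideal_subset:
  assumes noeth: "noetherian_ring R" and p: "has_char R p" and I: "ideal I R"
    and modulo: "\<And>z P. \<lbrakk>z \<in> carrier R; loc_map R U z \<in> tight_closure p L (ext_ideal R U I);
      minimal_prime P R; P \<inter> U = {}\<rbrakk> \<Longrightarrow> \<exists>u\<in>U. tight_modulo p I P (u \<otimes> z)"
  shows "tight_closure p L (ext_ideal R U I) \<subseteq> ext_ideal R U (tight_closure p R I)"
proof
  interpret I: ideal I R by fact
  interpret E: ideal "ext_ideal R U I" L by (rule ext_ideal_ideal[OF I])
  interpret T: ideal "tight_closure p L (ext_ideal R U I)" L
    by (rule L.tight_closure_ideal[OF has_char_localization[OF p] E.a_subset])
  have "p > 0" using p prime_gt_0_nat by (auto simp: has_char_def)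
  fix x assume xT: "x \<in> tight_closure p L (ext_ideal R U I)"
  obtain z v where z: "z \<in> carrier R" "v \<in> U" "x = frac R U z v"
    by (rule localization_cases[OF T.Icarr[OF xT]])
  have zT: "loc_map R U z \<in> tight_closure p L (ext_ideal R U I)"
    using xT unfolding z(3) frac_mem_ideal_iff[OF T.is_ideal z(1,2)] .
  have each: "\<exists>u\<in>U. tight_modulo p I P (u \<otimes> z)" if P: "minimal_prime P R" for P
  proof (cases "P \<inter> U = {}")
    case True
    then show ?thesis by (rule modulo[OF z(1) zT P])
  next
    case False
    then obtain u where u: "u \<in> P" "u \<in> U" by blast
    interpret P: primeideal P R using P by (simp add: minimal_prime_def)
    have "tight_modulo p I P (u \<otimes> z)"
      by (rule tight_modulo_of_mem[OF I.a_subset P.primeideal P.I_r_closed[OF u(1) z(1)] \<open>p > 0\<close>])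
    then show ?thesis using u(2) by (rule bexI)
  qed
  have "\<exists>u\<in>U. \<forall>P\<in>N. tight_modulo p I P (u \<otimes> z)"
    if "finite N" "N \<subseteq> {P. minimal_prime P R}" for N
    using that
  proof (induction N rule: finite_induct)
    case empty
    show ?case using U_one by blast
  next
    case (insert P N)
    have N: "N \<subseteq> {P. minimal_prime P R}" and P: "minimal_prime P R" using insert.prems by simp_all
    have id: "ideal M R" if "M \<in> insert P N" for M
      using subsetD[OF insert.prems that] primeideal.axioms(1)[of M R] by (simp add: minimal_prime_def)
    obtain u where u: "u \<in> U" "\<forall>M\<in>N. tight_modulo p I M (u \<otimes> z)"
      using insert.IH[OF N] by (elim bexE) (rule that)
    obtain w where w: "w \<in> U" "tight_modulo p I P (w \<otimes> z)"
      using each[OF P] by (elim bexE) (rule that)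
    note carr = u(1)[THEN U_carrier] w(1)[THEN U_carrier] z(1)
    have "tight_modulo p I M ((u \<otimes> w) \<otimes> z)" if M: "M \<in> insert P N" for M
    proof (cases "M = P")
      case True
      have "tight_modulo p I M (u \<otimes> (w \<otimes> z))"
        by (rule tight_modulo_mult[OF I.a_subset id[OF M]]) (use w(2) carr True in simp_all)
      then show ?thesis using carr by (simp add: m_assoc)
    next
      case False
      then have "tight_modulo p I M (u \<otimes> z)" using u(2) M by simp
      then have "tight_modulo p I M (w \<otimes> (u \<otimes> z))"
        by (rule tight_modulo_mult[OF I.a_subset id[OF M] m_closed[OF carr(1,3)] carr(2)])
      moreover have "(u \<otimes> w) \<otimes> z = w \<otimes> (u \<otimes> z)" using carr by (simp add: m_ac)
      ultimately show ?thesis by simp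
    qed
    then show ?case by (intro bexI[OF _ U_mult[OF u(1) w(1)]] ballI)
  qed
  from this[OF noetherian_minimal_primes(1)[OF noeth] order.refl]
  obtain u where u: "u \<in> U" "\<forall>P\<in>{P. minimal_prime P R}. tight_modulo p I P (u \<otimes> z)"
    by (elim bexE) (rule that)
  have "u \<otimes> z \<in> tight_closure p R I"
    by (rule tight_closure_modulo_minimal_primes[OF noeth p I.a_subset])
      (use u z(1) in \<open>simp_all add: U_carrier\<close>)
  then show "x \<in> ext_ideal R U (tight_closure p R I)"
    unfolding z(3) frac_mem_ext_ideal_iff[OF tight_closure_ideal[OF p I.a_subset] z(1,2)]
    by (rule bexI[OF _ u(1)])
qed

theorem mainTheorem1:
  fixes R :: "('a, 'm) ring_scheme" and p :: nat
  assumes "cring R"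
    and "noetherian_ring R"
    and "has_char R p"
    and "\<And>P. minimal_prime P R \<Longrightarrow>
           \<exists>(S :: 'b ring) f. domain S \<and> module_finite_ext (R Quot P) S f \<and>
             tc_commutes_with_localization p S"
  shows "tc_commutes_with_localization p R"
  unfolding tc_commutes_with_localization_def
proof (intro allI impI equalityI; elim conjE)
  fix I U assume I: "ideal I R" and U: "mult_system U R"
  interpret localizing R U by (intro localizing.intro localizing_axioms.intro assms(1) U)
  show "ext_ideal R U (tight_closure p R I) \<subseteq> tight_closure p L (ext_ideal R U I)"
    by (rule ext_ideal_tight_closure_subset[OF assms(3) I])
  show "tight_closure p L (ext_ideal R U I) \<subseteq> ext_ideal R U (tight_closure p R I)"
  proof (rule tight_closure_ext_ideal_subset[OF assms(2,3) I])
    fix z P assume z: "z \<in> carrier R" "loc_map R U z \<in> tight_closure p L (ext_ideal R U I)"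
      and P: "minimal_prime P R" "P \<inter> U = {}"
    obtain S :: "'b ring" and f where S: "domain S" "module_finite_ext (R Quot P) S f"
      "tc_commutes_with_localization p S"
      using assms(4)[OF P(1)] by (elim exE conjE) (rule that)
    show "\<exists>u\<in>U. tight_modulo p I P (u \<otimes>\<^bsub>R\<^esub> z)"
      by (rule tight_closure_modulo_prime[OF assms(3) I z P S])
  qed
qed

end
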